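(* Let $\lambda_1,\dots,\lambda_n$ be distinct points in $\mathbb{D}$ and let $(x_{1j},x_{2j},x_{3j})\in\overline{\mathcal{E}}$ be such that $x_{1j}x_{2j}\neq x_{3j}$ for $j=1,\dots,n$. Then the following are equivalent. (i) There exists a holomorphic function $x:\mathbb{D}\to\overline{\mathcal{E}}$ such that $x(\lambda_j)=(x_{1j},x_{2j},x_{3j})$ for $j=1,\dots,n$. (ii) There exists a rational $\overline{\mathcal{E}}$-inner function $x$ such that $x(\lambda_j)=(x_{1j},x_{2j},x_{3j})$ for $j=1,\dots,n$. (iii) For every triple of distinct points $z_1,z_2,z_3$ in $\mathbb{D}$, there exist positive $3n$-square matrices $N=[N_{il,jk}]_{i,j=1,\,l,k=1}^{n,3}$ of rank at most $1$ and $M=[M_{il,jk}]_{i,j=1,\,l,k=1}^{n,3}$ such that, for $1\le i,j\le n$ and $1\le l,k\le 3$, $$1-\overline{\frac{z_lx_{3i}-x_{1i}}{x_{2i}z_l-1}}\,\frac{z_kx_{3j}-x_{1j}}{x_{2j}z_k-1}=(1-\overline{z_l}z_k)N_{il,jk}+(1-\overline{\lambda_i}\lambda_j)M_{il,jk}.$$ (iv) For some distinct points $z_1,z_2,z_3$ in $\mathbb{D}$, there exist positive $3n$-square matrices $N=[N_{il,jk}]_{i,j=1,\,l,k=1}^{n,3}$ of rank at most $1$ and $M=[M_{il,jk}]_{i,j=1,\,l,k=1}^{n,3}$ such that $$\left[1-\overline{\frac{z_lx_{3i}-x_{1i}}{x_{2i}z_l-1}}\,\frac{z_kx_{3j}-x_{1j}}{x_{2j}z_k-1}\right]\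 \ge\ \left[(1-\overline{z_l}z_k)N_{il,jk}\right]+\left[(1-\overline{\lambda_i}\lambda_j)M_{il,jk}\right].$$
   Context: $\mathbb{D}$ is the open unit disc and $\mathbb{T}$ the unit circle. The closed tetrablock is $\overline{\mathcal{E}}=\{(x_1,x_2,x_3)\in\mathbb{C}^3:1-x_1z-x_2w+x_3zw\neq 0\text{ for all }z,w\in\mathbb{D}\}$, the closure of the open tetrablock $\mathcal{E}$ (same definition with $z,w\in\overline{\mathbb{D}}$). Its distinguished boundary $b\overline{\mathcal{E}}$ is the Shilov boundary of the algebra of continuous functions on $\overline{\mathcal{E}}$ that are analytic on $\mathcal{E}$; it is known that $b\overline{\mathcal{E}}=\{x\in\overline{\mathcal{E}}:|x_3|=1\}$. An $\overline{\mathcal{E}}$-inner function is an analytic function $\varphi:\mathbb{D}\to\overline{\mathcal{E}}$ such that for almost all $\lambda\in\mathbb{T}$ (Lebesgue measure) the radial limit $\lim_{r\to1-}\varphi(r\lambda)$ exists and belongs to $b\overline{\mathcal{E}}$. It is rational if its three components are rational functions. A "positive" matrix means a positive semidefinite Hermitian matrix. The $3n$-square matrices are indexed by pairs: rows by $(i,l)$ and columns by $(j,k)$ with $1\le i,j\le n$, $1\le l,k\le 3$. For Hermitian matrices, $P\ge Q$ means $P-Q$ is positive semidefinite. *)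

theory Defs
  imports "HOL-Complex_Analysis.Complex_Analysis"
begin

abbreviation unit_disc :: "complex set" where
  "unit_disc \<equiv> ball 0 1"

definition tetrablock :: "(complex ^ 3) set" where
  "tetrablock = {x. \<forall>z \<in> cball 0 1. \<forall>w \<in> cball 0 1.
     1 - x $ 1 * z - x $ 2 * w + x $ 3 * z * w \<noteq> 0}"

definition closed_tetrablock :: "(complex ^ 3) set" where
  "closed_tetrablock = {x. \<forall>z \<in> unit_disc. \<forall>w \<in> unit_disc.
     1 - x $ 1 * z - x $ 2 * w + x $ 3 * z * w \<noteq> 0}"

text \<open>
  Analyticity in several complex variables (on an open set): Frechet differentiability with a
  complex-linear derivative at every point.
\<close>
definition analytic_several_on :: "(complex ^ 'm \<Rightarrow> complex) \<Rightarrow> (complex ^ 'm) set \<Rightarrow> bool" where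
  "analytic_several_on f S \<longleftrightarrow>
     (\<forall>x \<in> S. \<exists>D. (f has_derivative D) (at x) \<and> (\<forall>c v. D (c *s v) = c * D v))"

definition tetrablock_algebra :: "(complex ^ 3 \<Rightarrow> complex) set" where
  "tetrablock_algebra =
     {f. continuous_on closed_tetrablock f \<and> analytic_several_on f tetrablock}"

text \<open>A closed boundary for a set of functions on \<open>X\<close>: a closed subset of \<open>X\<close> on which every
  function in the set attains its maximum modulus over \<open>X\<close>.\<close>
definition closed_boundary ::
    "('a::topological_space \<Rightarrow> complex) set \<Rightarrow> 'a set \<Rightarrow> 'a set \<Rightarrow> bool" where
  "closed_boundary A X F \<longleftrightarrow>
     closed F \<and> F \<subseteq> X \<and> (\<forall>f \<in> A. \<exists>y \<in> F. \<forall>x \<in> X. norm (f x) \<le> norm (f y))"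

text \<open>The Shilov boundary is the smallest closed boundary. For a uniform algebra on a compact
  space it exists by Shilov's theorem, and is then the intersection of all closed boundaries.\<close>
definition shilov_boundary ::
    "('a::topological_space \<Rightarrow> complex) set \<Rightarrow> 'a set \<Rightarrow> 'a set" where
  "shilov_boundary A X = \<Inter> {F. closed_boundary A X F}"

definition distinguished_boundary :: "(complex ^ 3) set" where
  "distinguished_boundary = shilov_boundary tetrablock_algebra closed_tetrablock"

definition holomorphic_into_tetrablock :: "(complex \<Rightarrow> complex ^ 3) \<Rightarrow> bool" where
  "holomorphic_into_tetrablock x \<longleftrightarrow>
     (\<forall>k. (\<lambda>s. x s $ k) holomorphic_on unit_disc) \<and> x ` unit_disc \<subseteq> closed_tetrablock"

text \<open>Null sets of the unit circle are those of the angle parameter \<open>t\<close> under \<open>t \<mapsto> cis t\<close>.\<close>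
definition tetra_inner :: "(complex \<Rightarrow> complex ^ 3) \<Rightarrow> bool" where
  "tetra_inner x \<longleftrightarrow> holomorphic_into_tetrablock x \<and>
     (AE t in lebesgue_on {0..2 * pi}. \<exists>y \<in> distinguished_boundary.
        ((\<lambda>r. x (of_real r * cis t)) \<longlongrightarrow> y) (at_left 1))"

text \<open>Functions on the disc given by a rational function. For a function holomorphic on the disc
  the quotient can be taken in lowest terms, so its denominator has no zero there.\<close>
definition rational_on_disc :: "(complex \<Rightarrow> complex) \<Rightarrow> bool" where
  "rational_on_disc f \<longleftrightarrow>
     (\<exists>p q. \<forall>s \<in> unit_disc. poly q s \<noteq> 0 \<and> f s = poly p s / poly q s)"

definition rational_tetra_inner :: "(complex \<Rightarrow> complex ^ 3) \<Rightarrow> bool" where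
  "rational_tetra_inner x \<longleftrightarrow> tetra_inner x \<and> (\<forall>k. rational_on_disc (\<lambda>s. x s $ k))"

definition hermitian :: "complex ^ 'm ^ 'm \<Rightarrow> bool" where
  "hermitian A \<longleftrightarrow> (\<forall>p q. A $ q $ p = cnj (A $ p $ q))"

text \<open>The quadratic form of a Hermitian matrix is real-valued, so \<open>Re\<close> loses nothing.\<close>
definition psd :: "complex ^ 'm ^ 'm \<Rightarrow> bool" where
  "psd A \<longleftrightarrow> hermitian A \<and>
     (\<forall>v. 0 \<le> Re (\<Sum>p\<in>UNIV. \<Sum>q\<in>UNIV. cnj (v $ p) * A $ p $ q * v $ q))"

definition loewner_ge :: "complex ^ 'm ^ 'm \<Rightarrow> complex ^ 'm ^ 'm \<Rightarrow> bool" where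
  "loewner_ge P Q \<longleftrightarrow> psd (P - Q)"

definition tetra_Psi :: "complex \<Rightarrow> complex ^ 3 \<Rightarrow> complex" where
  "tetra_Psi z x = (z * x $ 3 - x $ 1) / (x $ 2 * z - 1)"

end

theory Submission
  imports Defs "HOL-Real_Asymp.Real_Asymp"
begin

text \<open>
  A matrix function \<open>F\<close> of the \<open>2 \<times> 2\<close> Schur class yields a map \<open>x = (F\<^sub>1\<^sub>1, F\<^sub>2\<^sub>2, det F)\<close> into the
  closed tetrablock, and \<open>F(\<lambda>) (1, z \<gamma>) = (\<Psi>(z, x(\<lambda>)), \<gamma>)\<close> for \<open>\<gamma> = F\<^sub>2\<^sub>1 / (1 - F\<^sub>2\<^sub>2 z)\<close>. Thus the
  equality in (iii), with \<open>N = [cnj \<gamma> * \<gamma>]\<close>, says that \<open>M\<close> is the Pick kernel of \<open>F\<close> compressed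
  to the vectors \<open>(1, z \<gamma>)\<close>.

  (i) implies (iii): after a dilation \<open>x(r \<cdot>)\<close> the function \<open>x\<^sub>1 x\<^sub>2 - x\<^sub>3\<close> is analytic across the circle
  with finitely many zeros in the disc and none on the circle. It then factors as \<open>F\<^sub>1\<^sub>2 F\<^sub>2\<^sub>1\<close> with \<open>\<bar>F\<^sub>1\<^sub>2\<bar> = \<bar>F\<^sub>2\<^sub>1\<bar>\<close>
  on the circle, which makes \<open>F\<close> contractive there. Let \<open>r\<close> tend to \<open>1\<close>; only the numbers \<open>\<gamma>\<close>
  need a compactness argument, because they determine \<open>M\<close>.

  (iv) implies (ii): the slack matrix divided entrywise by \<open>1 - cnj \<lambda>\<^sub>i * \<lambda>\<^sub>j\<close> is positive and can be
  absorbed into \<open>M\<close>, so equality may be assumed. The lurking isometry then extends to a unitary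
  matrix, whose transfer function is a rational inner \<open>F\<close>. Three values of \<open>\<Psi>(\<cdot>, x)\<close> determine
  \<open>x\<close>, since \<open>x\<^sub>1 x\<^sub>2 \<noteq> x\<^sub>3\<close>.
\<close>

subsection \<open>The closed tetrablock and contractions\<close>

lemma one_minus_cnj_mult_ne_0:
  fixes a b :: complex
  assumes "norm a < 1" "norm b < 1"
  shows "1 - cnj a * b \<noteq> 0"
proof -
  have "norm (cnj a * b) < 1 * 1"
    unfolding norm_mult complex_mod_cnj using assms by (intro mult_strict_mono) auto
  then show ?thesis by auto
qed

text \<open>For fixed \<open>w\<close> the polynomial is affine in \<open>z\<close>, and its root
  \<open>(1 - b * w) / (a - c * w)\<close> would lie in the disc if the bound failed.\<close>

lemma tetra_lft_bound:
  fixes a b c w :: complex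
  assumes nz: "\<And>z w. norm z < 1 \<Longrightarrow> norm w < 1 \<Longrightarrow> 1 - a * z - b * w + c * z * w \<noteq> 0"
    and w: "norm w < 1"
  shows "norm (a - c * w) \<le> norm (1 - b * w)"
proof (rule ccontr)
  assume "\<not> ?thesis"
  then have lt: "norm (1 - b * w) < norm (a - c * w)" by simp
  then have ne: "a - c * w \<noteq> 0" by auto
  define z where "z = (1 - b * w) / (a - c * w)"
  have "norm z < 1" using lt ne by (simp add: z_def norm_divide)
  moreover have "z * (a - c * w) = 1 - b * w" using ne by (simp add: z_def)
  then have "1 - a * z - b * w + c * z * w = 0" by (simp add: algebra_simps)
  ultimately show False using nz w by blast
qed

lemma tetra_lft_bound_circle:
  fixes a b c w :: complex
  assumes nz: "\<And>z w. norm z < 1 \<Longrightarrow> norm w < 1 \<Longrightarrow> 1 - a * z - b * w + c * z * w \<noteq> 0"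
    and w: "norm w = 1"
  shows "norm (a - c * w) \<le> norm (1 - b * w)"
proof -
  have "closed {w. norm (a - c * w) \<le> norm (1 - b * w)}"
    by (intro closed_Collect_le continuous_intros)
  moreover have "ball 0 1 \<subseteq> {w. norm (a - c * w) \<le> norm (1 - b * w)}"
    using tetra_lft_bound[OF nz] by auto
  ultimately have "closure (ball 0 1) \<subseteq> {w. norm (a - c * w) \<le> norm (1 - b * w)}"
    by (rule closure_minimal[rotated])
  moreover have "w \<in> closure (ball 0 1)" using w by simp
  ultimately show ?thesis by blast
qed

lemma norm_diff_sq: "(norm (a - b))\<^sup>2 = (norm a)\<^sup>2 + (norm b)\<^sup>2 - 2 * Re (cnj a * b)" for a b :: complex
  unfolding cmod_power2 by (simp add: power2_eq_square algebra_simps)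

text \<open>Squaring the bound on the circle leaves \<open>2 * Re (s * w)\<close> as the only term
  that depends on \<open>w\<close>; a rotation of \<open>w\<close> turns it into
  \<open>2 * norm s\<close>.\<close>

lemma tetra_modulus_ineq:
  fixes a b c :: complex
  assumes nz: "\<And>z w. norm z < 1 \<Longrightarrow> norm w < 1 \<Longrightarrow> 1 - a * z - b * w + c * z * w \<noteq> 0"
  shows "(norm a)\<^sup>2 + (norm c)\<^sup>2 + 2 * norm (b - cnj a * c) \<le> 1 + (norm b)\<^sup>2"
proof -
  define s where "s = b - cnj a * c"
  \<comment> \<open>The unimodular number with \<open>s * w = norm s\<close>; for
    \<open>s = 0\<close> any unimodular value serves.\<close>
  define w where "w = (if s = 0 then 1 else cnj s / norm s)"
  have w1: "norm w = 1" by (simp add: w_def norm_divide)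
  have "s * cnj s = of_real ((norm s)\<^sup>2)" by (simp only: complex_norm_square)
  then have sw: "s * w = norm s"
    by (auto simp: w_def power2_eq_square)
  have "(norm (a - c * w))\<^sup>2 \<le> (norm (1 - b * w))\<^sup>2"
    using tetra_lft_bound_circle[OF nz w1] by (intro power_mono) auto
  then have "(norm a)\<^sup>2 + (norm c)\<^sup>2 - 2 * Re (cnj a * (c * w)) \<le> 1 + (norm b)\<^sup>2 - 2 * Re (b * w)"
    by (simp add: norm_diff_sq norm_mult w1)
  moreover have "Re (b * w) - Re (cnj a * (c * w)) = norm s"
    using arg_cong[OF sw, of Re] by (simp add: s_def algebra_simps)
  ultimately show ?thesis unfolding s_def by linarith
qed

definition contraction2 :: "complex \<Rightarrow> complex \<Rightarrow> complex \<Rightarrow> complex \<Rightarrow> bool" where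
  "contraction2 f11 f12 f21 f22 \<longleftrightarrow> (\<forall>\<alpha> \<beta>.
     (norm (f11 * \<alpha> + f12 * \<beta>))\<^sup>2 + (norm (f21 * \<alpha> + f22 * \<beta>))\<^sup>2 \<le> (norm \<alpha>)\<^sup>2 + (norm \<beta>)\<^sup>2)"

lemma norm_sq_identity:
  fixes a b c :: complex
  shows "(norm (b - cnj a * c))\<^sup>2 - (norm (a * b - c))\<^sup>2
    = (1 - (norm a)\<^sup>2) * ((norm b)\<^sup>2 - (norm c)\<^sup>2)"
  unfolding cmod_power2 by (simp add: power2_eq_square algebra_simps)

text \<open>For the last bound, \<open>2 * u \<le> p + q\<close> and
  \<open>u\<^sup>2 - v\<^sup>2 = p * q\<close> give
  \<open>(2 * v)\<^sup>2 \<le> (p - q)\<^sup>2\<close>. The claim is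
  \<open>2 * v \<le> p - q\<close>, so only the sign of \<open>p - q\<close> is left to
  settle.\<close>

lemma tetra_moduli:
  fixes a b c :: complex
  assumes nz: "\<And>z w. norm z < 1 \<Longrightarrow> norm w < 1 \<Longrightarrow> 1 - a * z - b * w + c * z * w \<noteq> 0"
  shows "norm a \<le> 1" "norm b \<le> 1" "norm c \<le> 1"
    and "(norm a)\<^sup>2 + (norm b)\<^sup>2 + 2 * norm (a * b - c) \<le> 1 + (norm c)\<^sup>2"
proof -
  have nz': "1 - b * z - a * w + c * z * w \<noteq> 0" if "norm z < 1" "norm w < 1" for z w
    using nz[OF that(2,1)] by (simp add: algebra_simps)
  show a1: "norm a \<le> 1" using tetra_lft_bound[of a b c 0, OF nz] by simp
  show b1: "norm b \<le> 1" using tetra_lft_bound[of b a c 0, OF nz'] by simp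
  note E1 = tetra_modulus_ineq[of a b c, OF nz] and E2 = tetra_modulus_ineq[of b a c, OF nz']
  have "(norm c)\<^sup>2 \<le> 1"
    using E1 E2 norm_ge_zero[of "b - cnj a * c"] norm_ge_zero[of "a - cnj b * c"] by linarith
  then show c1: "norm c \<le> 1" by (simp add: abs_square_le_1)
  define p where "p = 1 - (norm a)\<^sup>2"
  define q where "q = (norm b)\<^sup>2 - (norm c)\<^sup>2"
  define u where "u = norm (b - cnj a * c)"
  define v where "v = norm (a * b - c)"
  have id: "u\<^sup>2 - v\<^sup>2 = p * q" unfolding p_def q_def u_def v_def by (rule norm_sq_identity)
  have u: "0 \<le> u" "2 * u \<le> p + q" using E1 by (auto simp: u_def p_def q_def)
  have "(2 * u)\<^sup>2 \<le> (p + q)\<^sup>2" using u by (intro power_mono) auto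
  then have "(2 * v)\<^sup>2 \<le> (p - q)\<^sup>2" using id by (simp add: power2_eq_square algebra_simps)
  then have v: "2 * v \<le> \<bar>p - q\<bar>" using abs_le_square_iff[of "2 * v" "p - q"] by (simp add: v_def)
  \<comment> \<open>If \<open>p < q\<close>, then \<open>v \<ge> norm a * norm b - norm c\<close>
    gives \<open>(1 - norm c)\<^sup>2 \<le> (norm a - norm b)\<^sup>2\<close>. Hence
    \<open>norm a\<close> or \<open>norm b\<close> is at most \<open>norm c\<close>, and either case
    contradicts \<open>p < q\<close>.\<close>
  have "q \<le> p"
  proof (rule ccontr)
    assume "\<not> q \<le> p"
    then have lt: "p < q" by simp
    have "norm a * norm b - norm c \<le> v"
      unfolding v_def using norm_triangle_ineq2[of "a * b" c] by (simp add: norm_mult)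
    moreover have "2 * v \<le> q - p" using v lt by simp
    ultimately have "2 * (norm a * norm b - norm c) \<le> q - p" by simp
    then have "(1 - norm c)\<^sup>2 \<le> (norm a - norm b)\<^sup>2"
      unfolding p_def q_def by (simp add: power2_eq_square algebra_simps)
    then have "1 - norm c \<le> \<bar>norm a - norm b\<bar>"
      using abs_le_square_iff[of "1 - norm c" "norm a - norm b"] c1 by simp
    then have "norm b \<le> norm c \<or> norm a \<le> norm c" using a1 b1 by linarith
    then have "(norm b)\<^sup>2 \<le> (norm c)\<^sup>2 \<or> (norm a)\<^sup>2 \<le> (norm c)\<^sup>2"
      by (auto intro: power_mono)
    moreover have "(norm a)\<^sup>2 \<le> 1" "(norm b)\<^sup>2 \<le> 1" using a1 b1 by (auto simp: power_le_one)
    ultimately show False using lt unfolding p_def q_def by linarith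
  qed
  then show "(norm a)\<^sup>2 + (norm b)\<^sup>2 + 2 * norm (a * b - c) \<le> 1 + (norm c)\<^sup>2"
    using v unfolding p_def q_def v_def by linarith
qed

section \<open>Contractive matrices of order two with given diagonal and determinant\<close>

lemma contraction2_defect:
  fixes f11 f12 f21 f22 \<alpha> \<beta> :: complex
  shows "(norm \<alpha>)\<^sup>2 + (norm \<beta>)\<^sup>2 - ((norm (f11 * \<alpha> + f12 * \<beta>))\<^sup>2 + (norm (f21 * \<alpha> + f22 * \<beta>))\<^sup>2)
    = (1 - (norm f11)\<^sup>2 - (norm f21)\<^sup>2) * (norm \<alpha>)\<^sup>2 + (1 - (norm f12)\<^sup>2 - (norm f22)\<^sup>2) * (norm \<beta>)\<^sup>2
      - 2 * Re (cnj \<alpha> * (cnj f11 * f12 + cnj f21 * f22) * \<beta>)"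
  unfolding cmod_power2 by (simp add: power2_eq_square algebra_simps)

text \<open>For the matrix \<open>F\<close> with these entries this is
  \<open>det (1 - F* F) = 1 - tr (F* F) + det (F* F)\<close>.\<close>

lemma det_one_minus_gram:
  fixes f11 f12 f21 f22 :: complex
  shows "(1 - (norm f11)\<^sup>2 - (norm f21)\<^sup>2) * (1 - (norm f12)\<^sup>2 - (norm f22)\<^sup>2)
      - (norm (cnj f11 * f12 + cnj f21 * f22))\<^sup>2
    = 1 - (norm f11)\<^sup>2 - (norm f21)\<^sup>2 - (norm f12)\<^sup>2 - (norm f22)\<^sup>2 + (norm (f11 * f22 - f12 * f21))\<^sup>2"
  unfolding cmod_power2 by (simp add: power2_eq_square algebra_simps)

text \<open>With \<open>norm f = norm g\<close>, both squares equal \<open>norm (a * b - c)\<close>,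
  so the last bound of \<open>tetra_moduli\<close> says exactly that \<open>1 - F* F\<close> has
  nonnegative determinant. Its trace \<open>P + Q\<close> is nonnegative as well, so the form is
  positive.\<close>

lemma tetra_contraction2:
  fixes a b c f g :: complex
  assumes nz: "\<And>z w. norm z < 1 \<Longrightarrow> norm w < 1 \<Longrightarrow> 1 - a * z - b * w + c * z * w \<noteq> 0"
    and fg: "f * g = a * b - c" "norm f = norm g"
  shows "contraction2 a f g b"
proof -
  define P where "P = 1 - (norm a)\<^sup>2 - (norm g)\<^sup>2"
  define Q where "Q = 1 - (norm f)\<^sup>2 - (norm b)\<^sup>2"
  define s where "s = cnj a * f + cnj g * b"
  have v: "(norm f)\<^sup>2 = norm (a * b - c)" "(norm g)\<^sup>2 = norm (a * b - c)"
    using fg by (simp_all add: power2_eq_square norm_mult flip: fg(1))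
  note m = tetra_moduli[OF nz]
  have det: "P * Q - (norm s)\<^sup>2 \<ge> 0"
    unfolding P_def Q_def s_def det_one_minus_gram fg(1) using m(4) v by simp
  have c1: "(norm c)\<^sup>2 \<le> 1" using m(3) by (simp add: power_le_one)
  have tr: "P + Q \<ge> 0" using m(4) v c1 unfolding P_def Q_def by simp
  have PQ: "P \<ge> 0" "Q \<ge> 0"
  proof -
    have "P * Q \<ge> 0" using det zero_le_power2[of "norm s"] by linarith
    then show "P \<ge> 0" "Q \<ge> 0" using tr by (auto simp: zero_le_mult_iff)
  qed
  have s: "norm s \<le> sqrt P * sqrt Q"
    using det by (simp add: real_le_rsqrt flip: real_sqrt_mult)
  show ?thesis unfolding contraction2_def
  proof (intro allI)
    fix \<alpha> \<beta>
    have "Re (cnj \<alpha> * s * \<beta>) \<le> norm \<alpha> * norm s * norm \<beta>"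
      using complex_Re_le_cmod[of "cnj \<alpha> * s * \<beta>"] by (simp add: norm_mult)
    also have "\<dots> \<le> norm \<alpha> * (sqrt P * sqrt Q) * norm \<beta>"
      using s by (intro mult_right_mono mult_left_mono) auto
    also have "\<dots> = (sqrt P * norm \<alpha>) * (sqrt Q * norm \<beta>)" by simp
    finally have "2 * Re (cnj \<alpha> * s * \<beta>) \<le> (sqrt P * norm \<alpha>)\<^sup>2 + (sqrt Q * norm \<beta>)\<^sup>2"
      using sum_squares_bound[of "sqrt P * norm \<alpha>" "sqrt Q * norm \<beta>"] by linarith
    also have "\<dots> = P * (norm \<alpha>)\<^sup>2 + Q * (norm \<beta>)\<^sup>2" using PQ by (simp add: power_mult_distrib)
    finally have "0 \<le> (norm \<alpha>)\<^sup>2 + (norm \<beta>)\<^sup>2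
        - ((norm (a * \<alpha> + f * \<beta>))\<^sup>2 + (norm (g * \<alpha> + b * \<beta>))\<^sup>2)"
      unfolding contraction2_defect P_def Q_def s_def by linarith
    then show "(norm (a * \<alpha> + f * \<beta>))\<^sup>2 + (norm (g * \<alpha> + b * \<beta>))\<^sup>2 \<le> (norm \<alpha>)\<^sup>2 + (norm \<beta>)\<^sup>2"
      by linarith
  qed
qed

lemma contraction2_norm_le_1:
  assumes "contraction2 f11 f12 f21 f22"
  shows "norm f11 \<le> 1"
proof -
  have "(norm f11)\<^sup>2 + (norm f21)\<^sup>2 \<le> 1"
    using assms[unfolded contraction2_def, rule_format, of 1 0] by simp
  then have "(norm f11)\<^sup>2 \<le> 1" using zero_le_power2[of "norm f21"] by linarith
  then show "norm f11 \<le> 1" by (simp add: abs_square_le_1)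
qed

text \<open>The polynomial is \<open>det (1 - F diag(z, w))\<close>. At a zero, \<open>F\<close>
  would map \<open>(z * p, w * q)\<close> to the strictly longer vector
  \<open>(p, q)\<close>.\<close>

lemma contraction2_tetra:
  assumes F: "contraction2 f11 f12 f21 f22" and z: "norm z < 1" and w: "norm w < 1"
  shows "1 - f11 * z - f22 * w + (f11 * f22 - f12 * f21) * z * w \<noteq> 0"
proof
  assume 0: "1 - f11 * z - f22 * w + (f11 * f22 - f12 * f21) * z * w = 0"
  define q where "q = 1 - f11 * z"
  define p where "p = f12 * w"
  have "norm (f11 * z) < 1"
    using contraction2_norm_le_1[OF F] z by (simp add: norm_mult mult_le_less_imp_less le_less_trans[OF mult_right_mono])
  then have q0: "q \<noteq> 0" by (auto simp: q_def)
  have "f11 * (z * p) + f12 * (w * q) = p" by (simp add: p_def q_def algebra_simps)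
  moreover have "f21 * (z * p) + f22 * (w * q) = q"
    using 0 by (simp add: p_def q_def algebra_simps)
  ultimately have "(norm p)\<^sup>2 + (norm q)\<^sup>2 \<le> (norm (z * p))\<^sup>2 + (norm (w * q))\<^sup>2"
    using F unfolding contraction2_def by metis
  moreover have "(norm (z * p))\<^sup>2 \<le> (norm p)\<^sup>2"
    using z by (intro power_mono) (auto simp: norm_mult mult_left_le_one_le)
  moreover have "norm (w * q) < norm q" using w q0 by (simp add: norm_mult)
  then have "(norm (w * q))\<^sup>2 < (norm q)\<^sup>2" by (intro power_strict_mono) auto
  ultimately show False by linarith
qed

lemma closed_tetrablockD:
  fixes x :: "complex ^ 3"
  assumes "x \<in> closed_tetrablock" "norm z < 1" "norm w < 1"
  shows "1 - x $ 1 * z - x $ 2 * w + x $ 3 * z * w \<noteq> 0"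
  using assms by (auto simp: closed_tetrablock_def)

lemma closed_tetrablockI:
  fixes x :: "complex ^ 3"
  assumes "contraction2 f11 f12 f21 f22" "x $ 1 = f11" "x $ 2 = f22" "x $ 3 = f11 * f22 - f12 * f21"
  shows "x \<in> closed_tetrablock"
  using contraction2_tetra[OF assms(1)] assms(2-) by (auto simp: closed_tetrablock_def)

lemma closed_tetrablock_denom_ne:
  fixes x :: "complex ^ 3"
  assumes "x \<in> closed_tetrablock" "norm z < 1"
  shows "x $ 2 * z \<noteq> 1"
  using closed_tetrablockD[OF assms(1), of 0 z] assms(2) by auto

subsection \<open>The Pick inequality on the circle\<close>

text \<open>On the circle \<open>cnj (1 / (e t - p)) = e t / (1 - cnj p * e t)\<close>, so the
  integral is the Cauchy integral at \<open>q\<close> of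
  \<open>h u = f u / (1 - cnj p * u)\<close>.\<close>

lemma Cauchy_pairing:
  fixes f :: "complex \<Rightarrow> complex" and e :: "real \<Rightarrow> complex"
  assumes f: "continuous_on (cball 0 1) f" "f holomorphic_on ball 0 1"
    and p: "norm p < 1" and q: "norm q < 1"
  defines "e \<equiv> \<lambda>t. exp (2 * of_real pi * \<i> * of_real t)"
  shows "((\<lambda>t. cnj (1 / (e t - p)) * (f (e t) * (1 / (e t - q)))) has_integral f q / (1 - cnj p * q)) {0..1}"
proof -
  define h where "h u = f u / (1 - cnj p * u)" for u
  have den: "1 - cnj p * u \<noteq> 0" if "norm u \<le> 1" for u
  proof -
    have "norm (cnj p * u) \<le> norm p * 1" unfolding norm_mult complex_mod_cnj using that by (intro mult_left_mono) auto
    with p show ?thesis by auto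
  qed
  have "continuous_on (cball 0 1) h" unfolding h_def
    using den by (intro continuous_intros f) auto
  moreover have "h holomorphic_on ball 0 1" unfolding h_def
    using den by (intro holomorphic_intros f) auto
  ultimately have "((\<lambda>u. h u / (u - q)) has_contour_integral (2 * of_real pi * \<i> * h q)) (circlepath 0 1)"
    using q by (intro Cauchy_integral_circlepath) auto
  then have "((\<lambda>t. h (circlepath 0 1 t) / (circlepath 0 1 t - q) *
      vector_derivative (circlepath 0 1) (at t within {0..1})) has_integral 2 * of_real pi * \<i> * h q) {0..1}"
    by (simp add: has_contour_integral_def)
  then have "((\<lambda>t. 1 / (2 * of_real pi * \<i>) * (h (circlepath 0 1 t) / (circlepath 0 1 t - q) *
      vector_derivative (circlepath 0 1) (at t within {0..1})))
      has_integral 1 / (2 * of_real pi * \<i>) * (2 * of_real pi * \<i> * h q)) {0..1}"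
    by (rule has_integral_mult_right)
  then have "((\<lambda>t. 1 / (2 * of_real pi * \<i>) * (h (circlepath 0 1 t) / (circlepath 0 1 t - q) *
      vector_derivative (circlepath 0 1) (at t within {0..1}))) has_integral f q / (1 - cnj p * q)) {0..1}"
    by (simp add: h_def)
  moreover have "1 / (2 * of_real pi * \<i>) * (h (circlepath 0 1 t) / (circlepath 0 1 t - q) *
      vector_derivative (circlepath 0 1) (at t within {0..1}))
      = cnj (1 / (e t - p)) * (f (e t) * (1 / (e t - q)))" if t: "t \<in> {0..1}" for t
  proof -
    have vd: "vector_derivative (circlepath 0 1) (at t within {0..1}) = 2 * of_real pi * \<i> * e t"
      using t by (simp add: vector_derivative_circlepath01 e_def)
    have c: "circlepath 0 1 t = e t" by (simp add: circlepath e_def)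
    have n1: "norm (e t) = 1" by (simp add: e_def)
    then have ee: "e t * cnj (e t) = 1" using complex_norm_square[of "e t"] by simp
    have ne: "cnj (e t) - cnj p \<noteq> 0" using n1 p by (auto simp flip: complex_cnj_diff)
    have "1 - cnj p * e t = e t * (cnj (e t) - cnj p)" using ee by (simp add: algebra_simps)
    moreover have "e t \<noteq> 0" using n1 by auto
    ultimately have "1 / (1 - cnj p * e t) * e t = 1 / (cnj (e t) - cnj p)" using ne by simp
    then have k: "cnj (1 / (e t - p)) = 1 / (1 - cnj p * e t) * e t" by simp
    have cancel: "1 / k * (x * (k * y)) = x * y" if "k \<noteq> 0" for k x y :: complex using that by simp
    show ?thesis unfolding vd c h_def k by (subst cancel) simp_all
  qed
  ultimately show ?thesis by (rule has_integral_eq[rotated])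
qed

lemma Cauchy_pairing_sum:
  fixes f :: "complex \<Rightarrow> complex" and e :: "real \<Rightarrow> complex" and c d lam :: "'p::finite \<Rightarrow> complex"
  assumes f: "continuous_on (cball 0 1) f" "f holomorphic_on ball 0 1"
    and lam: "\<And>p. norm (lam p) < 1"
  defines "e \<equiv> \<lambda>t. exp (2 * of_real pi * \<i> * of_real t)"
  defines "K \<equiv> \<lambda>c t. \<Sum>p\<in>UNIV. c p * (1 / (e t - lam p))"
  shows "((\<lambda>t. cnj (K c t) * (f (e t) * K d t)) has_integral
    (\<Sum>p\<in>UNIV. \<Sum>q\<in>UNIV. cnj (c p) * (f (lam q) * d q) / (1 - cnj (lam p) * lam q))) {0..1}"
proof -
  have expand: "(\<Sum>p\<in>UNIV. \<Sum>q\<in>UNIV. cnj (c p) * d q * (cnj (r p) * (x * r q)))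
      = cnj (\<Sum>p\<in>UNIV. c p * r p) * (x * (\<Sum>q\<in>UNIV. d q * r q))" for r :: "'p \<Rightarrow> complex" and x
    by (simp add: sum_product sum_distrib_left mult_ac)
  have "((\<lambda>t. \<Sum>p\<in>UNIV. \<Sum>q\<in>UNIV. cnj (c p) * d q *
        (cnj (1 / (e t - lam p)) * (f (e t) * (1 / (e t - lam q))))) has_integral
     (\<Sum>p\<in>UNIV. \<Sum>q\<in>UNIV. cnj (c p) * d q * (f (lam q) / (1 - cnj (lam p) * lam q)))) {0..1}"
    unfolding e_def by (intro has_integral_sum has_integral_mult_right Cauchy_pairing f lam) auto
  moreover have "(\<Sum>p\<in>UNIV. \<Sum>q\<in>UNIV. cnj (c p) * d q *
        (cnj (1 / (e t - lam p)) * (f (e t) * (1 / (e t - lam q))))) = cnj (K c t) * (f (e t) * K d t)" for t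
    unfolding K_def by (rule expand)
  ultimately show ?thesis by (simp add: mult_ac)
qed

text \<open>The defect of a contractive multiplier is tested on the combinations
  \<open>\<Sum> c\<^sub>p / (\<zeta> - \<lambda>\<^sub>p)\<close> of the orthocomplement of the Hardy space in the
  Lebesgue space of the circle.\<close>
lemma Pick_inequality:
  fixes lam c d :: "'p::finite \<Rightarrow> complex"
  assumes f11: "continuous_on (cball 0 1) f11" "f11 holomorphic_on ball 0 1"
    and f12: "continuous_on (cball 0 1) f12" "f12 holomorphic_on ball 0 1"
    and f21: "continuous_on (cball 0 1) f21" "f21 holomorphic_on ball 0 1"
    and f22: "continuous_on (cball 0 1) f22" "f22 holomorphic_on ball 0 1"
    and F: "\<And>s. norm s = 1 \<Longrightarrow> contraction2 (f11 s) (f12 s) (f21 s) (f22 s)"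
    and lam: "\<And>p. norm (lam p) < 1"
  defines "u \<equiv> \<lambda>p. f11 (lam p) * c p + f12 (lam p) * d p"
    and "v \<equiv> \<lambda>p. f21 (lam p) * c p + f22 (lam p) * d p"
  shows "0 \<le> Re (\<Sum>p\<in>UNIV. \<Sum>q\<in>UNIV. (cnj (c p) * c q + cnj (d p) * d q - cnj (u p) * u q - cnj (v p) * v q)
      / (1 - cnj (lam p) * lam q))"
proof -
  define e :: "real \<Rightarrow> complex" where "e t = exp (2 * of_real pi * \<i> * of_real t)" for t
  define K where "K c t = (\<Sum>p\<in>UNIV. c p * (1 / (e t - lam p)))" for c t
  define G where "G a f b = (\<Sum>p\<in>UNIV. \<Sum>q\<in>UNIV. cnj (a p) * (f (lam q) * b q) / (1 - cnj (lam p) * lam q))"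
    for a b :: "'p \<Rightarrow> complex" and f :: "complex \<Rightarrow> complex"
  have I: "((\<lambda>t. cnj (K a t) * (f (e t) * K b t)) has_integral G a f b) {0..1}"
    if "continuous_on (cball 0 1) f" "f holomorphic_on ball 0 1" for f a b
    using Cauchy_pairing_sum[OF that lam, where c = a and d = b] by (simp add: K_def G_def e_def)
  have one: "continuous_on (cball 0 1) (\<lambda>_. 1 :: complex)" "(\<lambda>_. 1 :: complex) holomorphic_on ball 0 1"
    by (auto intro: holomorphic_intros continuous_intros)
  define J where "J t = cnj (K c t) * (1 * K c t) + cnj (K d t) * (1 * K d t)
      - 2 * (cnj (K u t) * (f11 (e t) * K c t) + cnj (K u t) * (f12 (e t) * K d t))
      + cnj (K u t) * (1 * K u t)
      - 2 * (cnj (K v t) * (f21 (e t) * K c t) + cnj (K v t) * (f22 (e t) * K d t))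
      + cnj (K v t) * (1 * K v t)" for t
  have "(J has_integral G c (\<lambda>_. 1) c + G d (\<lambda>_. 1) d - 2 * (G u f11 c + G u f12 d) + G u (\<lambda>_. 1) u
      - 2 * (G v f21 c + G v f22 d) + G v (\<lambda>_. 1) v) {0..1}" (is "(_ has_integral ?V) _")
    unfolding J_def
    by (intro has_integral_add has_integral_diff has_integral_mult_right I[OF f11] I[OF f12] I[OF f21] I[OF f22]
        I[OF one])
  then have "((Re \<circ> J) has_integral Re ?V) {0..1}"
    by (rule has_integral_linear[OF _ bounded_linear_Re])
  moreover have "0 \<le> (Re \<circ> J) t" for t
  proof -
    have sq: "2 * Re (cnj x * y) \<le> (norm x)\<^sup>2 + (norm y)\<^sup>2" for x y :: complex
      using norm_diff_sq[of x y] zero_le_power2[of "norm (x - y)"] by linarith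
    have nn: "Re (cnj x * x) = (norm x)\<^sup>2" for x :: complex
      unfolding cmod_power2 by (simp add: power2_eq_square)
    have "norm (e t) = 1" by (simp add: e_def)
    from F[OF this] have "(norm (f11 (e t) * K c t + f12 (e t) * K d t))\<^sup>2
        + (norm (f21 (e t) * K c t + f22 (e t) * K d t))\<^sup>2 \<le> (norm (K c t))\<^sup>2 + (norm (K d t))\<^sup>2"
      by (simp add: contraction2_def)
    moreover have "(Re \<circ> J) t = (norm (K c t))\<^sup>2 + (norm (K d t))\<^sup>2
       - 2 * Re (cnj (K u t) * (f11 (e t) * K c t + f12 (e t) * K d t)) + (norm (K u t))\<^sup>2
       - 2 * Re (cnj (K v t) * (f21 (e t) * K c t + f22 (e t) * K d t)) + (norm (K v t))\<^sup>2"
      unfolding J_def nn[symmetric] by (simp add: distrib_left)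
    ultimately show ?thesis
      using sq[of "K u t" "f11 (e t) * K c t + f12 (e t) * K d t"]
        sq[of "K v t" "f21 (e t) * K c t + f22 (e t) * K d t"] by linarith
  qed
  ultimately have "0 \<le> Re ?V" by (rule has_integral_nonneg)
  also have "G u f11 c + G u f12 d = G u (\<lambda>_. 1) u"
    unfolding G_def by (simp add: u_def distrib_left add_divide_distrib sum.distrib)
  also have "G v f21 c + G v f22 d = G v (\<lambda>_. 1) v"
    unfolding G_def by (simp add: v_def distrib_left add_divide_distrib sum.distrib)
  also have "G c (\<lambda>_. 1) c + G d (\<lambda>_. 1) d - 2 * G u (\<lambda>_. 1) u + G u (\<lambda>_. 1) u
      - 2 * G v (\<lambda>_. 1) v + G v (\<lambda>_. 1) v
    = (\<Sum>p\<in>UNIV. \<Sum>q\<in>UNIV. (cnj (c p) * c q + cnj (d p) * d q - cnj (u p) * u q - cnj (v p) * v q)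
      / (1 - cnj (lam p) * lam q))"
    by (simp add: G_def add_divide_distrib diff_divide_distrib sum.distrib sum_subtractf)
  finally show ?thesis .
qed

subsection \<open>From interpolants to the matrix condition\<close>

text \<open>The cofactor known near \<open>z0\<close> is glued with
  \<open>g z / (z - z0) ^ n\<close>; the two agree where both are defined.\<close>

lemma holomorphic_factor_zero_on:
  fixes g :: "complex \<Rightarrow> complex"
  assumes g: "g holomorphic_on S" "open S" "connected S" "z0 \<in> S" "\<exists>w\<in>S. g w \<noteq> 0"
  obtains n :: nat and h where "h holomorphic_on S" "h z0 \<noteq> 0" "\<And>z. z \<in> S \<Longrightarrow> g z = (z - z0) ^ n * h z"
proof -
  define n where "n = nat (zorder g z0)"
  define k where "k = zor_poly g z0"
  obtain r where r: "r > 0" "cball z0 r \<subseteq> S" "k holomorphic_on cball z0 r"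
    and k: "\<And>w. w \<in> cball z0 r \<Longrightarrow> g w = k w * (w - z0) ^ n \<and> k w \<noteq> 0"
    using zorder_exist_zero[OF g] unfolding n_def k_def by blast
  define h where "h z = (if z = z0 then k z0 else g z / (z - z0) ^ n)" for z
  have hk: "h z = k z" if "z \<in> cball z0 r" for z
    using k[OF that] by (auto simp: h_def)
  have "k holomorphic_on ball z0 r" using r(3) by (rule holomorphic_on_subset) auto
  then have "h holomorphic_on ball z0 r"
    by (rule holomorphic_transform) (use hk in auto)
  moreover have "(\<lambda>z. g z / (z - z0) ^ n) holomorphic_on S - {z0}"
    by (intro holomorphic_intros holomorphic_on_subset[OF g(1)]) auto
  then have "h holomorphic_on S - {z0}"
    by (rule holomorphic_transform) (auto simp: h_def)
  ultimately have "h holomorphic_on ball z0 r \<union> (S - {z0})"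
    using g(2) by (intro holomorphic_on_Un) auto
  then have "h holomorphic_on S" by (rule holomorphic_on_subset) (use r(1) in auto)
  moreover have "h z0 \<noteq> 0" using k[of z0] r(1) by (simp add: h_def)
  moreover have "g z = (z - z0) ^ n * h z" if "z \<in> S" for z
    using k[of z0] r(1) by (auto simp: h_def)
  ultimately show ?thesis using that by blast
qed

text \<open>A stand-in for the inner-outer factorization: each zero \<open>z\<^sub>0\<close> contributes the pair
  \<open>(z - z\<^sub>0) / s\<close>, \<open>s\<close> with \<open>s\<^sup>2 = 1 - cnj z\<^sub>0 * z\<close>, and \<open>\<bar>z - z\<^sub>0\<bar> = \<bar>s\<bar>\<^sup>2\<close>
  on the circle.\<close>
lemma balanced_factorization:
  fixes g :: "complex \<Rightarrow> complex"
  assumes "finite Z" "1 < R" "g holomorphic_on ball 0 R" "{z \<in> ball 0 R. g z = 0} = Z" "Z \<subseteq> ball 0 1"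
  shows "\<exists>R' a b. 1 < R' \<and> R' \<le> R \<and> a holomorphic_on ball 0 R' \<and> b holomorphic_on ball 0 R' \<and>
    (\<forall>z \<in> ball 0 R'. a z * b z = g z) \<and> (\<forall>z. norm z = 1 \<longrightarrow> norm (a z) = norm (b z))"
  using assms
proof (induction Z arbitrary: g R rule: finite_induct)
  case empty
  \<comment> \<open>Without zeros, a holomorphic square root of \<open>g\<close> serves as both
    factors.\<close>
  have "contractible (ball (0::complex) R)" by (simp add: convex_imp_contractible)
  then obtain a where "a holomorphic_on ball 0 R" "\<And>z. z \<in> ball 0 R \<Longrightarrow> g z = (a z)\<^sup>2"
    using contractible_imp_holomorphic_sqrt[of g "ball 0 R"] empty by blast
  then show ?case using empty by (intro exI[of _ R] exI[of _ a]) (auto simp: power2_eq_square)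
next
  case (insert z0 Z)
  have z0: "norm z0 < 1" using insert.prems by auto
  \<comment> \<open>A point outside the unit disc, where all zeros lie, shows that \<open>g\<close>
    does not vanish identically.\<close>
  obtain t :: real where t: "1 < t" "t < R" using dense[OF insert.prems(1)] by blast
  have "of_real t \<in> ball (0::complex) R" "of_real t \<notin> ball (0::complex) 1" using t by auto
  then have "\<exists>w\<in>ball 0 R. g w \<noteq> 0" using insert.prems by blast
  moreover have "z0 \<in> ball 0 R" using z0 t by auto
  ultimately obtain n h where h: "h holomorphic_on ball 0 R" "h z0 \<noteq> 0"
      "\<And>z. z \<in> ball 0 R \<Longrightarrow> g z = (z - z0) ^ n * h z"
    using holomorphic_factor_zero_on[OF insert.prems(2) open_ball connected_ball] by metis
  have n: "n \<noteq> 0"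
  proof
    assume "n = 0"
    then have "g z0 = h z0" using h(3)[of z0] z0 insert.prems(1) by auto
    moreover have "g z0 = 0" using insert.prems(3) by auto
    ultimately show False using h(2) by simp
  qed
  have "{z \<in> ball 0 R. h z = 0} = Z"
  proof -
    have "h z = 0 \<longleftrightarrow> g z = 0 \<and> z \<noteq> z0" if "z \<in> ball 0 R" for z
      using h(2) h(3)[OF that] n by auto
    then have "{z \<in> ball 0 R. h z = 0} = {z \<in> ball 0 R. g z = 0} - {z0}" by auto
    then show ?thesis using insert.prems(3) insert.hyps(2) by auto
  qed
  then obtain R1 a b where R1: "1 < R1" "R1 \<le> R" and ab: "a holomorphic_on ball 0 R1" "b holomorphic_on ball 0 R1"
     "\<And>z. z \<in> ball 0 R1 \<Longrightarrow> a z * b z = h z" "\<And>z. norm z = 1 \<Longrightarrow> norm (a z) = norm (b z)"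
    using insert.IH[OF insert.prems(1) h(1)] insert.prems(4) by auto
  \<comment> \<open>Within radius \<open>1 / norm z0\<close> the number
    \<open>1 - cnj z0 * z\<close> stays in the right half-plane, where \<open>csqrt\<close> is
    holomorphic and nonzero.\<close>
  define R' where "R' = (if z0 = 0 then R1 else min R1 (1 / norm z0))"
  have R': "1 < R'" "R' \<le> R1" using R1 z0 by (auto simp: R'_def)
  have pos: "0 < Re (1 - cnj z0 * z)" if "z \<in> ball 0 R'" for z
  proof -
    have "norm (cnj z0 * z) < 1"
      using that by (cases "z0 = 0") (auto simp: norm_mult R'_def field_simps)
    then have "Re (cnj z0 * z) < 1" using complex_Re_le_cmod[of "cnj z0 * z"] by linarith
    then show ?thesis by simp
  qed
  define s where "s z = csqrt (1 - cnj z0 * z)" for z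
  have s0: "s z \<noteq> 0" if "z \<in> ball 0 R'" for z using pos[OF that] unfolding s_def csqrt_eq_0 by force
  have hs: "s holomorphic_on ball 0 R'" unfolding s_def
    by (intro holomorphic_intros) (use pos complex_nonpos_Reals_iff in fastforce)
  define a' where "a' z = (z - z0) ^ n / s z ^ n * a z" for z
  define b' where "b' z = s z ^ n * b z" for z
  have sub: "ball 0 R' \<subseteq> ball 0 R1" "ball 0 R' \<subseteq> ball 0 R" using R' R1 by auto
  have "a' holomorphic_on ball 0 R'" unfolding a'_def
    by (intro holomorphic_intros hs holomorphic_on_subset[OF ab(1) sub(1)]) (use s0 in auto)
  moreover have "b' holomorphic_on ball 0 R'" unfolding b'_def
    by (intro holomorphic_intros hs holomorphic_on_subset[OF ab(2) sub(1)])
  moreover have "a' z * b' z = g z" if "z \<in> ball 0 R'" for z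
  proof -
    have "z \<in> ball 0 R1" "z \<in> ball 0 R" using that sub by blast+
    then show ?thesis using s0[OF that] by (simp add: a'_def b'_def h(3) flip: ab(3))
  qed
  moreover have "norm (a' z) = norm (b' z)" if "norm z = 1" for z
  proof -
    have zb: "z \<in> ball 0 R'" using that R' by auto
    have "z * cnj z = 1" using complex_norm_square[of z] that by simp
    then have "1 - cnj z0 * z = z * cnj (z - z0)" by (simp add: algebra_simps)
    then have "norm (1 - cnj z0 * z) = norm (z - z0)"
      using that by (simp add: norm_mult del: complex_cnj_diff)
    moreover have "(norm (s z))\<^sup>2 = norm (1 - cnj z0 * z)"
      by (simp add: s_def flip: norm_power)
    ultimately have "norm (z - z0) = norm (s z) * norm (s z)" by (simp add: power2_eq_square)
    then show ?thesis using s0[OF zb] that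
      by (simp add: a'_def b'_def norm_mult norm_divide norm_power ab(4) power_mult_distrib)
  qed
  ultimately show ?case using R' R1 by (intro exI[of _ R'] exI[of _ a'] exI[of _ b']) auto
qed

text \<open>With \<open>N = [cnj \<gamma>\<^sub>p * \<gamma>\<^sub>q]\<close>, equality in condition (iii) determines \<open>M\<close> entrywise; this is
  that entry.\<close>
definition defect_entry ::
  "('p \<Rightarrow> complex) \<Rightarrow> ('p \<Rightarrow> complex) \<Rightarrow> ('p \<Rightarrow> complex) \<Rightarrow> ('p \<Rightarrow> complex) \<Rightarrow> 'p \<Rightarrow> 'p \<Rightarrow> complex" where
  "defect_entry lam z \<psi> \<gamma> p q = (1 - cnj (\<psi> p) * \<psi> q - (1 - cnj (z p) * z q) * (cnj (\<gamma> p) * \<gamma> q))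
     / (1 - cnj (lam p) * lam q)"

text \<open>Only the quadratic form is recorded: \<open>defect_entry\<close> is hermitian by its
  formula, so this is positivity of the kernel.\<close>

definition defect_nonneg ::
  "('p::finite \<Rightarrow> complex) \<Rightarrow> ('p \<Rightarrow> complex) \<Rightarrow> ('p \<Rightarrow> complex) \<Rightarrow> ('p \<Rightarrow> complex) \<Rightarrow> bool" where
  "defect_nonneg lam z \<psi> \<gamma> \<longleftrightarrow>
     (\<forall>v. 0 \<le> Re (\<Sum>p\<in>UNIV. \<Sum>q\<in>UNIV. cnj (v p) * defect_entry lam z \<psi> \<gamma> p q * v q))"

text \<open>The factors \<open>a\<close>, \<open>b\<close> of
  \<open>x\<^sub>1 x\<^sub>2 - x\<^sub>3\<close> complete the components to a matrix
  \<open>F\<close> with determinant \<open>x\<^sub>3\<close> that is contractive on the circle, so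
  \<open>Pick_inequality\<close> applies.\<close>

lemma defect_nonneg_regular:
  fixes x :: "complex \<Rightarrow> complex ^ 3" and lam z :: "'p::finite \<Rightarrow> complex"
  assumes R: "1 < R" and hol: "\<And>k. (\<lambda>s. x s $ k) holomorphic_on ball 0 R"
    and x: "\<And>s. s \<in> ball 0 R \<Longrightarrow> x s \<in> closed_tetrablock"
    and Z: "finite {s \<in> ball 0 R. x s $ 1 * x s $ 2 = x s $ 3}"
      "{s \<in> ball 0 R. x s $ 1 * x s $ 2 = x s $ 3} \<subseteq> ball 0 1"
    and lam: "\<And>p. norm (lam p) < 1" and z: "\<And>p. norm (z p) < 1"
  shows "\<exists>\<gamma>. defect_nonneg lam z (\<lambda>p. tetra_Psi (z p) (x (lam p))) \<gamma>"
proof -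
  have "(\<lambda>s. x s $ 1 * x s $ 2 - x s $ 3) holomorphic_on ball 0 R"
    by (intro holomorphic_intros hol)
  then obtain R' a b where R': "1 < R'" "R' \<le> R" and ab: "a holomorphic_on ball 0 R'" "b holomorphic_on ball 0 R'"
     "\<And>s. s \<in> ball 0 R' \<Longrightarrow> a s * b s = x s $ 1 * x s $ 2 - x s $ 3" "\<And>z. norm z = 1 \<Longrightarrow> norm (a z) = norm (b z)"
    using balanced_factorization[of "{s \<in> ball 0 R. x s $ 1 * x s $ 2 = x s $ 3}" R
        "\<lambda>s. x s $ 1 * x s $ 2 - x s $ 3"] R Z by auto
  have sub: "cball 0 1 \<subseteq> ball (0::complex) R'" "ball 0 1 \<subseteq> ball (0::complex) R'" "ball 0 R' \<subseteq> ball (0::complex) R"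
    using R' by auto
  have reg: "continuous_on (cball 0 1) f" "f holomorphic_on ball 0 1" if "f holomorphic_on ball 0 R'" for f
    using that sub by (auto intro: holomorphic_on_imp_continuous_on holomorphic_on_subset)
  have hol': "(\<lambda>s. x s $ k) holomorphic_on ball 0 R'" for k
    using hol sub(3) holomorphic_on_subset by blast
  have contr: "contraction2 (x s $ 1) (a s) (b s) (x s $ 2)" if "norm s = 1" for s
  proof -
    have s: "s \<in> ball 0 R'" using that R' by auto
    then have "x s \<in> closed_tetrablock" using x sub by auto
    then show ?thesis using tetra_contraction2[OF closed_tetrablockD] ab(3)[OF s] ab(4)[OF that] by blast
  qed
  define \<gamma> where "\<gamma> p = b (lam p) / (1 - x (lam p) $ 2 * z p)" for p
  define \<psi> where "\<psi> p = tetra_Psi (z p) (x (lam p))" for p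
  have lamR: "lam p \<in> ball 0 R'" for p using lam[of p] R' by auto
  have den: "1 - x (lam p) $ 2 * z p \<noteq> 0" for p
    using closed_tetrablock_denom_ne[OF x z] lamR sub by fastforce
  have F1: "x (lam p) $ 1 + a (lam p) * (z p * \<gamma> p) = \<psi> p" for p
  proof -
    have "x (lam p) $ 1 + a (lam p) * (z p * \<gamma> p)
        = (x (lam p) $ 1 * (1 - x (lam p) $ 2 * z p) + (a (lam p) * b (lam p)) * z p) / (1 - x (lam p) $ 2 * z p)"
      using den[of p] by (simp add: \<gamma>_def add_divide_distrib)
    also have "\<dots> = (x (lam p) $ 1 - z p * x (lam p) $ 3) / (1 - x (lam p) $ 2 * z p)"
      unfolding ab(3)[OF lamR] by (simp add: algebra_simps)
    also have "\<dots> = \<psi> p"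
      unfolding \<psi>_def tetra_Psi_def by (subst minus_divide_divide[symmetric]) simp
    finally show ?thesis .
  qed
  have F2: "b (lam p) + x (lam p) $ 2 * (z p * \<gamma> p) = \<gamma> p" for p
    using den[of p] by (simp add: \<gamma>_def divide_simps) (simp add: algebra_simps)
  have "0 \<le> Re (\<Sum>p\<in>UNIV. \<Sum>q\<in>UNIV. cnj (v p) * defect_entry lam z \<psi> \<gamma> p q * v q)" for v
  proof -
    \<comment> \<open>The test vectors are \<open>v p * (1, z p * \<gamma> p)\<close>, which
      \<open>F (lam p)\<close> maps to \<open>v p * (\<psi> p, \<gamma> p)\<close> by
      \<open>F1\<close> and \<open>F2\<close>.\<close>
    define d where "d p = v p * (z p * \<gamma> p)" for p
    have u: "x (lam p) $ 1 * v p + a (lam p) * d p = v p * \<psi> p" for p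
      unfolding d_def F1[symmetric] by (simp add: algebra_simps)
    have w: "b (lam p) * v p + x (lam p) $ 2 * d p = v p * \<gamma> p" for p
      unfolding d_def using arg_cong[OF F2[of p], of "\<lambda>x. v p * x"] by (simp add: algebra_simps)
    have "0 \<le> Re (\<Sum>p\<in>UNIV. \<Sum>q\<in>UNIV. (cnj (v p) * v q + cnj (d p) * d q
        - cnj (v p * \<psi> p) * (v q * \<psi> q) - cnj (v p * \<gamma> p) * (v q * \<gamma> q)) / (1 - cnj (lam p) * lam q))"
      using Pick_inequality[where lam = lam and c = v and d = d,
          OF reg[OF hol'[of 1]] reg[OF ab(1)] reg[OF ab(2)] reg[OF hol'[of 2]] contr lam]
      unfolding u w by simp
    moreover have "(cnj (v p) * v q + cnj (d p) * d q
        - cnj (v p * \<psi> p) * (v q * \<psi> q) - cnj (v p * \<gamma> p) * (v q * \<gamma> q)) / (1 - cnj (lam p) * lam q)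
       = cnj (v p) * defect_entry lam z \<psi> \<gamma> p q * v q" for p q
      by (simp add: defect_entry_def d_def algebra_simps add_divide_distrib diff_divide_distrib)
    ultimately show ?thesis by simp
  qed
  then show ?thesis unfolding defect_nonneg_def \<psi>_def by blast
qed

text \<open>A positive kernel has a nonnegative diagonal. The resulting bound on
  \<open>\<gamma>\<close> does not involve \<open>\<psi>\<close>, which is what a compactness
  argument needs.\<close>

lemma defect_nonneg_bound:
  assumes D: "defect_nonneg lam z \<psi> \<gamma>" and z: "norm (z p) < 1" and lam: "norm (lam p) < 1"
  shows "(1 - (norm (z p))\<^sup>2) * (norm (\<gamma> p))\<^sup>2 \<le> 1"
proof -
  define v where "v q = (if q = p then 1 else 0 :: complex)" for q
  have sq: "cnj c * c = of_real ((norm c)\<^sup>2)" for c :: complex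
    by (simp only: complex_norm_square mult.commute)
  have l1: "(norm (lam p))\<^sup>2 < 1" using lam by (simp add: abs_square_less_1)
  have "0 \<le> Re (\<Sum>r\<in>UNIV. \<Sum>q\<in>UNIV. cnj (v r) * defect_entry lam z \<psi> \<gamma> r q * v q)"
    using D unfolding defect_nonneg_def by blast
  also have "(\<Sum>r\<in>UNIV. \<Sum>q\<in>UNIV. cnj (v r) * defect_entry lam z \<psi> \<gamma> r q * v q) = defect_entry lam z \<psi> \<gamma> p p"
    by (simp add: v_def if_distrib[of cnj] if_distrib[of "\<lambda>x. x * _"] if_distrib[of "\<lambda>x. _ * x"] cong: if_cong)
  also have "\<dots> = of_real ((1 - (norm (\<psi> p))\<^sup>2 - (1 - (norm (z p))\<^sup>2) * (norm (\<gamma> p))\<^sup>2) / (1 - (norm (lam p))\<^sup>2))"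
    unfolding defect_entry_def sq by simp
  finally have "0 \<le> 1 - (norm (\<psi> p))\<^sup>2 - (1 - (norm (z p))\<^sup>2) * (norm (\<gamma> p))\<^sup>2"
    using l1 by (simp add: zero_le_divide_iff)
  then show ?thesis using zero_le_power2[of "norm (\<psi> p)"] by linarith
qed

text \<open>By \<open>defect_nonneg_bound\<close> the parameters \<open>\<gamma>\<close> stay in a
  bounded set, so a subsequence converges; the kernel entries depend continuously on
  \<open>\<psi>\<close> and \<open>\<gamma>\<close>.\<close>

lemma defect_nonneg_limit:
  fixes lam z \<psi> :: "'p::finite \<Rightarrow> complex" and \<psi>s :: "nat \<Rightarrow> 'p \<Rightarrow> complex"
  assumes D: "\<And>m. \<exists>\<gamma>. defect_nonneg lam z (\<psi>s m) \<gamma>"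
    and lim: "\<And>p. (\<lambda>m. \<psi>s m p) \<longlonglongrightarrow> \<psi> p"
    and z: "\<And>p. norm (z p) < 1" and lam: "\<And>p. norm (lam p) < 1"
  shows "\<exists>\<gamma>. defect_nonneg lam z \<psi> \<gamma>"
proof -
  obtain G where G: "\<And>m. defect_nonneg lam z (\<psi>s m) (G m)" using D by metis
  define V :: "nat \<Rightarrow> complex ^ 'p" where "V m = (\<chi> p. G m p)" for m
  have "norm (G m p) \<le> 1 / sqrt (1 - (norm (z p))\<^sup>2)" for m p
  proof -
    have z1: "0 < 1 - (norm (z p))\<^sup>2" using z[of p] by (simp add: abs_square_less_1)
    have "(norm (G m p))\<^sup>2 \<le> 1 / (1 - (norm (z p))\<^sup>2)"
      using defect_nonneg_bound[OF G z lam] z1 by (simp add: field_simps)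
    then have "norm (G m p) \<le> sqrt (1 / (1 - (norm (z p))\<^sup>2))" by (rule real_le_rsqrt)
    then show ?thesis by (simp add: real_sqrt_divide)
  qed
  then have "norm (V m) \<le> (\<Sum>p\<in>UNIV. 1 / sqrt (1 - (norm (z p))\<^sup>2))" for m
    unfolding norm_vec_def by (intro order.trans[OF L2_set_le_sum sum_mono]) (auto simp: V_def)
  then have "bounded (range V)" by (auto simp: bounded_iff)
  then obtain l r where r: "strict_mono (r :: nat \<Rightarrow> nat)" and l: "(V \<circ> r) \<longlonglongrightarrow> l"
    using bounded_imp_convergent_subsequence by blast
  have Gl: "(\<lambda>m. G (r m) p) \<longlonglongrightarrow> l $ p" for p
    using tendsto_vec_nth[OF l, of p] by (simp add: V_def o_def)
  have Pl: "(\<lambda>m. \<psi>s (r m) p) \<longlonglongrightarrow> \<psi> p" for p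
    using LIMSEQ_subseq_LIMSEQ[OF lim r] by (simp add: o_def)
  have "0 \<le> Re (\<Sum>p\<in>UNIV. \<Sum>q\<in>UNIV. cnj (v p) * defect_entry lam z \<psi> (\<lambda>p. l $ p) p q * v q)" for v
  proof (rule LIMSEQ_le_const)
    have ne: "1 - cnj (lam p) * lam q \<noteq> 0" for p q by (rule one_minus_cnj_mult_ne_0[OF lam lam])
    show "(\<lambda>m. Re (\<Sum>p\<in>UNIV. \<Sum>q\<in>UNIV. cnj (v p) * defect_entry lam z (\<psi>s (r m)) (G (r m)) p q * v q))
      \<longlonglongrightarrow> Re (\<Sum>p\<in>UNIV. \<Sum>q\<in>UNIV. cnj (v p) * defect_entry lam z \<psi> (\<lambda>p. l $ p) p q * v q)"
      unfolding defect_entry_def by (intro tendsto_intros Gl Pl ne)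
    show "\<exists>N. \<forall>n\<ge>N. 0 \<le> Re (\<Sum>p\<in>UNIV. \<Sum>q\<in>UNIV. cnj (v p) * defect_entry lam z (\<psi>s (r n)) (G (r n)) p q * v q)"
      using G unfolding defect_nonneg_def by blast
  qed
  then show ?thesis unfolding defect_nonneg_def by blast
qed

text \<open>A nonconstant \<open>g\<close> has finitely many zeros in a closed disc of radius
  \<open>k < 1\<close>. For \<open>r\<close> between the largest zero modulus below \<open>k\<close>
  and \<open>k\<close> itself, the zeros of \<open>g (r * s)\<close> with
  \<open>norm s < k / r\<close> lie in the open unit disc.\<close>

lemma zero_free_dilation:
  fixes g :: "complex \<Rightarrow> complex"
  assumes g: "g holomorphic_on ball 0 1" "w \<in> ball 0 1" "g w \<noteq> 0" and e: "0 < e" "e < 1"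
  obtains r R where "1 - e < r" "r < 1" "1 < R" "r * R < 1"
    "finite {s \<in> ball 0 R. g (of_real r * s) = 0}" "{s \<in> ball 0 R. g (of_real r * s) = 0} \<subseteq> ball 0 1"
proof (cases "g constant_on ball 0 1")
  \<comment> \<open>A constant \<open>g\<close> is handled apart: it has no zeros because
    \<open>g w \<noteq> 0\<close>, and any radii with \<open>r * R < 1\<close> will do.\<close>
  case True
  then have nz: "g s \<noteq> 0" if "s \<in> ball 0 1" for s using g that unfolding constant_on_def by metis
  define r where "r = 1 - e / 2"
  define R where "R = 1 + e / 4"
  have "r * R < 1" using e by (simp add: r_def R_def field_simps add_pos_pos)
  moreover have "g (of_real r * s) \<noteq> 0" if "s \<in> ball 0 R" for s
  proof -
    have "norm (of_real r * s) = r * norm s" using e by (simp only: norm_mult norm_of_real) (simp add: r_def)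
    also have "\<dots> \<le> r * R" using that e by (intro mult_left_mono) (auto simp: r_def)
    finally have "norm (of_real r * s) \<le> r * R" .
    with \<open>r * R < 1\<close> show ?thesis by (intro nz) auto
  qed
  then have "{s \<in> ball 0 R. g (of_real r * s) = 0} = {}" by auto
  moreover from this have "finite {s \<in> ball 0 R. g (of_real r * s) = 0}" by (metis finite.emptyI)
  ultimately show ?thesis using e by (intro that[of r R]) (auto simp: r_def R_def)
next
  case False
  define k where "k = 1 - e / 2"
  define Z where "Z = {s \<in> cball 0 k. g s = 0}"
  have "cball 0 k \<subseteq> ball (0::complex) 1" using e by (auto simp: k_def)
  then have Zf: "finite Z" unfolding Z_def
    using holomorphic_compact_finite_zeros[OF g(1), of "cball 0 k"] False by auto
  \<comment> \<open>Inserting \<open>1 - e\<close> makes the set nonempty and forces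
    \<open>r\<close> above \<open>1 - e\<close>.\<close>
  define A where "A = insert (1 - e) (norm ` {s \<in> Z. norm s < k})"
  have A: "finite A" "A \<noteq> {}" using Zf by (auto simp: A_def)
  have mk: "Max A < k" using A e by (auto simp: A_def k_def)
  have m1: "1 - e \<le> Max A" using A by (intro Max_ge) (auto simp: A_def)
  obtain r where r: "Max A < r" "r < k" using dense[OF mk] by blast
  have r0: "0 < r" "r < 1" using r m1 e by (auto simp: k_def)
  define R where "R = k / r"
  have R: "1 < R" "r * R = k" using r r0 by (auto simp: R_def)
  have sub: "norm (of_real r * s) < r \<and> of_real r * s \<in> Z" if s: "s \<in> ball 0 R" "g (of_real r * s) = 0" for s
  proof -
    have "norm (of_real r * s) < r * R" using s r0 by (simp add: norm_mult)
    then have lt: "norm (of_real r * s) < k" using R by simp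
    then have Zs: "of_real r * s \<in> Z" using s(2) by (simp add: Z_def)
    then have "norm (of_real r * s) \<in> A" using lt by (auto simp: A_def)
    then have "norm (of_real r * s) \<le> Max A" using A by simp
    then show ?thesis using r Zs by linarith
  qed
  have "inj (\<lambda>s::complex. of_real r * s)" using r0 by (auto simp: inj_on_def)
  then have "finite ((\<lambda>s. of_real r * s) -` Z)" using Zf by (simp add: finite_vimageI)
  then have fin: "finite {s \<in> ball 0 R. g (of_real r * s) = 0}" by (rule finite_subset[rotated]) (use sub in auto)
  have "{s \<in> ball 0 R. g (of_real r * s) = 0} \<subseteq> ball 0 1" using sub r0 by (fastforce simp: norm_mult)
  then show ?thesis using that[of r R] r r0 m1 R fin e by (auto simp: k_def)
qed

text \<open>Dilations make the interpolant regular across the circle; the point \<open>w\<close>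
  keeps \<open>x\<^sub>1 x\<^sub>2 - x\<^sub>3\<close> from vanishing identically. The dilated
  values of \<open>\<Psi>\<close> converge to the original ones at the nodes.\<close>

lemma defect_nonneg_exists:
  fixes x :: "complex \<Rightarrow> complex ^ 3" and lam z :: "'p::finite \<Rightarrow> complex"
  assumes x: "holomorphic_into_tetrablock x"
    and w: "w \<in> ball 0 1" "x w $ 1 * x w $ 2 \<noteq> x w $ 3"
    and lam: "\<And>p. norm (lam p) < 1" and z: "\<And>p. norm (z p) < 1"
  shows "\<exists>\<gamma>. defect_nonneg lam z (\<lambda>p. tetra_Psi (z p) (x (lam p))) \<gamma>"
proof -
  have hol: "(\<lambda>s. x s $ k) holomorphic_on ball 0 1"
    and cl: "\<And>s. s \<in> ball 0 1 \<Longrightarrow> x s \<in> closed_tetrablock" for k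
    using x by (auto simp: holomorphic_into_tetrablock_def)
  have g: "(\<lambda>s. x s $ 1 * x s $ 2 - x s $ 3) holomorphic_on ball 0 1" by (intro holomorphic_intros hol)
  have "\<exists>r. 1 - 1 / (real m + 2) < r \<and> r < 1 \<and>
     (\<exists>\<gamma>. defect_nonneg lam z (\<lambda>p. tetra_Psi (z p) (x (of_real r * lam p))) \<gamma>)" for m
  proof -
    \<comment> \<open>The summand \<open>2\<close> keeps the tolerance below \<open>1\<close> for
      \<open>m = 0\<close> too.\<close>
    have e: "0 < 1 / (real m + 2)" "1 / (real m + 2) < 1" by auto
    obtain r R where r: "1 - 1 / (real m + 2) < r" "r < 1" "1 < R" "r * R < 1"
      and Z: "finite {s \<in> ball 0 R. x (of_real r * s) $ 1 * x (of_real r * s) $ 2 - x (of_real r * s) $ 3 = 0}"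
        "{s \<in> ball 0 R. x (of_real r * s) $ 1 * x (of_real r * s) $ 2 - x (of_real r * s) $ 3 = 0} \<subseteq> ball 0 1"
      using zero_free_dilation[OF g w(1) _ e] w(2) by auto
    have r0: "0 < r" using r(1) e by linarith
    have img: "of_real r * s \<in> ball 0 1" if "s \<in> ball 0 R" for s :: complex
    proof -
      have "r * norm s < r * R" using that r0 by simp
      then have "r * norm s < 1" using r by linarith
      then show ?thesis using r0 by (simp add: norm_mult)
    qed
    have "(\<lambda>s. of_real r * s) ` ball 0 R \<subseteq> ball (0::complex) 1" using img by blast
    then have "(\<lambda>s. x (of_real r * s) $ k) holomorphic_on ball 0 R" for k
      using holomorphic_on_compose_gen[OF _ hol, of "\<lambda>s. of_real r * s" "ball 0 R" k]
      by (simp add: o_def holomorphic_intros)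
    then have "\<exists>\<gamma>. defect_nonneg lam z (\<lambda>p. tetra_Psi (z p) (x (of_real r * lam p))) \<gamma>"
      by (intro defect_nonneg_regular[where x = "\<lambda>s. x (of_real r * s)", OF r(3)] cl img lam z)
        (use Z in auto)
    with r show ?thesis by blast
  qed
  then obtain r where r: "\<And>m. 1 - 1 / (real m + 2) < r m" "\<And>m. r m < 1"
    and D: "\<And>m. \<exists>\<gamma>. defect_nonneg lam z (\<lambda>p. tetra_Psi (z p) (x (of_real (r m) * lam p))) \<gamma>"
    by metis
  have "(\<lambda>m. 1 - 1 / (real m + 2)) \<longlonglongrightarrow> 1" by real_asymp
  then have r1: "r \<longlonglongrightarrow> 1"
    by (rule tendsto_sandwich[rotated 2, OF _ tendsto_const]) (use r in \<open>auto intro!: always_eventually less_imp_le\<close>)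
  show ?thesis
  proof (rule defect_nonneg_limit[OF D _ z lam])
    fix p
    have pt: "(\<lambda>m. of_real (r m) * lam p) \<longlonglongrightarrow> lam p"
      using tendsto_mult_right[OF tendsto_of_real[OF r1], of "lam p"] by simp
    have "isCont (\<lambda>s. x s $ k) (lam p)" for k
      using holomorphic_on_imp_continuous_on[OF hol] lam[of p] by (auto simp: continuous_on_eq_continuous_at)
    then have xk: "(\<lambda>m. x (of_real (r m) * lam p) $ k) \<longlonglongrightarrow> x (lam p) $ k" for k
      using isCont_tendsto_compose pt by blast
    have "x (lam p) $ 2 * z p - 1 \<noteq> 0"
      using closed_tetrablock_denom_ne[OF cl z] lam[of p] by simp
    then show "(\<lambda>m. tetra_Psi (z p) (x (of_real (r m) * lam p))) \<longlonglongrightarrow> tetra_Psi (z p) (x (lam p))"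
      unfolding tetra_Psi_def by (intro tendsto_intros xk)
  qed
qed

subsection \<open>Positive matrices and the lurking isometry\<close>

text \<open>The complex inner product, conjugate-linear on the left; \<open>inner\<close> is its
  real part.\<close>

definition cip :: "complex ^ 'k \<Rightarrow> complex ^ 'k \<Rightarrow> complex" where
  "cip u v = (\<Sum>i\<in>UNIV. cnj (u $ i) * v $ i)"

lemma cip_add_right: "cip u (v + w) = cip u v + cip u w"
  and cip_diff_right: "cip u (v - w) = cip u v - cip u w"
  and cip_scale_right: "cip u (c *s v) = c * cip u v"
  and cip_add_left: "cip (u + v) w = cip u w + cip v w"
  and cip_diff_left: "cip (u - v) w = cip u w - cip v w"
  and cip_scale_left: "cip (c *s u) v = cnj c * cip u v"
  by (simp_all add: cip_def algebra_simps sum.distrib sum_subtractf sum_distrib_left)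

lemmas cip_simps = cip_add_right cip_diff_right cip_scale_right cip_add_left cip_diff_left cip_scale_left

lemma cip_commute: "cnj (cip u v) = cip v u"
  by (simp add: cip_def mult.commute)

lemma cip_self: "cip u u = of_real ((norm u)\<^sup>2)"
proof -
  have "(norm u)\<^sup>2 = (\<Sum>i\<in>UNIV. (norm (u $ i))\<^sup>2)"
    by (simp add: norm_vec_def L2_set_def sum_nonneg)
  then show ?thesis unfolding cip_def
    by (simp add: complex_norm_square mult.commute del: of_real_power)
qed

lemma cip_self_eq_0: "cip u u = 0 \<longleftrightarrow> u = 0"
  by (simp add: cip_self)

lemma cip_axis: "cip (axis s 1) w = w $ s" "cip w (axis s 1) = cnj (w $ s)"
  by (simp_all add: cip_def axis_def if_distrib[of cnj] if_distrib[of "\<lambda>x. x * _"] if_distrib[of "\<lambda>x. _ * x"] cong: if_cong)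

lemma matrix_axis: "(A *v axis s 1) $ p = A $ p $ s" for A :: "complex ^ 'k ^ 'k"
  by (simp add: matrix_vector_mult_def axis_def if_distrib[of "\<lambda>x. _ * x"] cong: if_cong)

definition cunitary :: "complex ^ 'k ^ 'k \<Rightarrow> bool" where
  "cunitary L \<longleftrightarrow> (\<forall>u v. cip (L *v u) (L *v v) = cip u v)"

lemma cunitary_norm:
  assumes "cunitary L"
  shows "norm (L *v u) = norm u"
proof -
  have "cip (L *v u) (L *v u) = cip u u" using assms by (simp add: cunitary_def)
  then have "(norm (L *v u))\<^sup>2 = (norm u)\<^sup>2" unfolding cip_self of_real_eq_iff .
  then show ?thesis by simp
qed

text \<open>A complex Householder map. Along \<open>a - b\<close> it multiplies by a unimodular number, which is
  \<open>-1\<close> only when \<open>cip a b\<close> is real.\<close>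
lemma cunitary_Householder:
  fixes a b :: "complex ^ 'k"
  assumes ab: "cip a a = cip b b"
  shows "\<exists>R. cunitary R \<and> R *v a = b \<and> (\<forall>w. cip (a - b) w = 0 \<longrightarrow> R *v w = w)"
proof (cases "a = b")
  case True
  then show ?thesis by (intro exI[of _ "mat 1"]) (simp add: cunitary_def)
next
  case False
  define d where "d = a - b"
  define s where "s = cip d a"
  \<comment> \<open>The value for which \<open>1 - \<kappa> d d*\<close> sends \<open>a\<close> to
    \<open>a - d = b\<close>. Equal lengths of \<open>a\<close> and \<open>b\<close> give
    \<open>cip d d = s + cnj s\<close>, which makes the map unitary.\<close>
  define \<kappa> where "\<kappa> = 1 / s"
  define R :: "complex ^ 'k ^ 'k" where "R = mat 1 - (\<chi> i j. \<kappa> * d $ i * cnj (d $ j))"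
  have R: "R *v w = w - (\<kappa> * cip d w) *s d" for w
  proof -
    have "(\<chi> i j. \<kappa> * d $ i * cnj (d $ j)) *v w = (\<kappa> * cip d w) *s d"
      by (simp add: vec_eq_iff matrix_vector_mult_def cip_def sum_distrib_left sum_distrib_right mult_ac)
    then show ?thesis by (simp add: R_def matrix_vector_mult_diff_rdistrib)
  qed
  have "cip b b = cip a a" using ab by simp
  then have D: "cip d d = s + cnj s"
    unfolding s_def cip_commute d_def by (simp add: cip_simps)
  have "cip d d \<noteq> 0" using False by (simp add: cip_self_eq_0 d_def)
  then have s: "s \<noteq> 0" using D by auto
  have \<kappa>: "\<kappa> + cnj \<kappa> = cnj \<kappa> * \<kappa> * cip d d"
    using s unfolding D \<kappa>_def by (simp add: field_simps)
  have "cip (R *v u) (R *v v) = cip u v" for u v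
  proof -
    have "cip (R *v u) (R *v v) = cip u v - \<kappa> * cip d v * cip u d
        - cnj \<kappa> * cnj (cip d u) * cip d v + cnj \<kappa> * cnj (cip d u) * (\<kappa> * cip d v) * cip d d"
      unfolding R by (simp add: cip_simps algebra_simps)
    also have "\<dots> = cip u v - cip d v * cip u d * ((\<kappa> + cnj \<kappa>) - cnj \<kappa> * \<kappa> * cip d d)"
      unfolding cip_commute by (simp add: algebra_simps)
    finally show ?thesis unfolding \<kappa> by simp
  qed
  moreover have "R *v a = b"
    using s unfolding R s_def[symmetric] \<kappa>_def by (simp add: d_def)
  ultimately show ?thesis by (intro exI[of _ R]) (auto simp: cunitary_def R simp flip: d_def)
qed

text \<open>The isometry \<open>u p \<mapsto> v p\<close> is extended to the whole space one vector
  at a time. Given \<open>L\<close> for \<open>S\<close>, a Householder map moves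
  \<open>L *v u s\<close> to \<open>v s\<close>; equality of the Gram matrices makes
  \<open>L *v u s - v s\<close> orthogonal to each earlier \<open>v p\<close>, which therefore stays
  fixed.\<close>

lemma cunitary_of_equal_Gram:
  fixes u v :: "'i \<Rightarrow> complex ^ 'k"
  assumes "finite S" "\<And>p q. p \<in> S \<Longrightarrow> q \<in> S \<Longrightarrow> cip (u p) (u q) = cip (v p) (v q)"
  shows "\<exists>L. cunitary L \<and> (\<forall>p\<in>S. L *v u p = v p)"
  using assms
proof (induction S rule: finite_induct)
  case empty
  then show ?case by (intro exI[of _ "mat 1"]) (simp add: cunitary_def)
next
  case (insert s S)
  then obtain L where L: "cunitary L" "\<And>p. p \<in> S \<Longrightarrow> L *v u p = v p" by auto
  define a where "a = L *v u s"
  have aw: "cip a (v p) = cip (v s) (v p)" if "p \<in> S" for p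
  proof -
    have "cip a (v p) = cip (u s) (u p)"
      using L(1) unfolding a_def L(2)[OF that, symmetric] by (simp add: cunitary_def)
    then show ?thesis using insert.prems that by auto
  qed
  have "cip a a = cip (v s) (v s)"
    using L(1) insert.prems[of s s] by (simp add: cunitary_def a_def)
  then obtain R where R: "cunitary R" "R *v a = v s" "\<And>w. cip (a - v s) w = 0 \<Longrightarrow> R *v w = w"
    using cunitary_Householder by blast
  have "R ** L *v u p = v p" if "p \<in> insert s S" for p
  proof (cases "p = s")
    case True
    then show ?thesis using R(2) by (simp add: a_def flip: matrix_vector_mul_assoc)
  next
    case False
    then have p: "p \<in> S" using that by simp
    then show ?thesis using R(3)[of "v p"] aw[OF p] L(2)
      by (simp add: cip_diff_left flip: matrix_vector_mul_assoc)
  qed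
  moreover have "cunitary (R ** L)"
    using R(1) L(1) by (simp add: cunitary_def flip: matrix_vector_mul_assoc)
  ultimately show ?case by blast
qed

section \<open>Positive semidefinite matrices: elimination, Gram vectors, rank one, Szego
  quotients\<close>

lemma psd_iff_cip: "psd A \<longleftrightarrow> hermitian A \<and> (\<forall>v. 0 \<le> Re (cip v (A *v v)))"
  unfolding psd_def cip_def matrix_vector_mult_def by (simp add: sum_distrib_left mult.assoc)

lemma hermitian_cip:
  assumes "hermitian A"
  shows "cip u (A *v v) = cip (A *v u) v"
proof -
  have A: "cnj (A $ q $ p) = A $ p $ q" for p q using assms by (metis hermitian_def)
  have "cip u (A *v v) = (\<Sum>p\<in>UNIV. \<Sum>q\<in>UNIV. cnj (u $ p) * (A $ p $ q * v $ q))"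
    by (simp add: cip_def matrix_vector_mult_def sum_distrib_left)
  also have "\<dots> = (\<Sum>q\<in>UNIV. \<Sum>p\<in>UNIV. cnj (u $ p) * (A $ p $ q * v $ q))" by (rule sum.swap)
  also have "\<dots> = cip (A *v u) v"
    by (simp add: cip_def matrix_vector_mult_def sum_distrib_left sum_distrib_right A mult_ac)
  finally show ?thesis .
qed

text \<open>Prepares completing the square in one coordinate: the choice of \<open>t\<close>
  produces both the vanishing row and the Schur complement.\<close>

lemma hermitian_cip_shift:
  fixes A :: "complex ^ 'k ^ 'k"
  assumes "hermitian A"
  shows "cip (v - t *s axis s 1) (A *v (v - t *s axis s 1))
    = cip v (A *v v) - cnj t * (A *v v) $ s - t * cnj ((A *v v) $ s) + cnj t * t * A $ s $ s"
proof -
  have As: "(A *v axis s 1) $ s = A $ s $ s"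
    by (simp add: matrix_axis)
  have "cip v (A *v axis s 1) = cnj ((A *v v) $ s)"
    unfolding hermitian_cip[OF assms] cip_axis ..
  then show ?thesis
    by (simp add: matrix_vector_mult_diff_distrib vector_scalar_commute cip_simps cip_axis As algebra_simps)
qed

lemma hermitian_diag_real: "hermitian (A :: complex ^ 'k ^ 'k) \<Longrightarrow> cnj (A $ s $ s) = A $ s $ s"
  by (metis hermitian_def)

lemma psd_cnj: "cnj (A $ p $ q) = A $ q $ p" if "psd A" for A :: "complex ^ 'k ^ 'k"
  using that unfolding psd_def hermitian_def by metis

lemma psd_diag:
  fixes A :: "complex ^ 'k ^ 'k"
  assumes "psd A"
  shows "A $ s $ s = of_real (Re (A $ s $ s))" "0 \<le> Re (A $ s $ s)"
proof -
  show "A $ s $ s = of_real (Re (A $ s $ s))"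
    using hermitian_diag_real[of A s] assms by (simp add: psd_def complex_eq_iff)
  have "0 \<le> Re (cip (axis s 1) (A *v axis s 1))" using assms unfolding psd_iff_cip by blast
  then show "0 \<le> Re (A $ s $ s)" by (simp add: cip_axis matrix_axis)
qed

lemma psd_diag_sqrt:
  fixes A :: "complex ^ 'k ^ 'k"
  assumes "psd A"
  shows "of_real (sqrt (Re (A $ s $ s))) * of_real (sqrt (Re (A $ s $ s))) = A $ s $ s"
  unfolding of_real_mult[symmetric] using psd_diag(2)[OF assms, of s] psd_diag(1)[OF assms, of s, symmetric]
  by simp

text \<open>With a zero diagonal entry the form is affine along the axis \<open>s\<close>, so a
  nonzero entry in that row would make it negative somewhere.\<close>

lemma psd_zero_diag_row:
  fixes A :: "complex ^ 'k ^ 'k"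
  assumes A: "psd A" and 0: "A $ s $ s = 0"
  shows "A $ s $ p = 0"
proof (rule ccontr)
  assume ne: "A $ s $ p \<noteq> 0"
  define n where "n = (norm (A $ s $ p))\<^sup>2"
  have n: "0 < n" using ne by (simp add: n_def)
  \<comment> \<open>Chosen so that the form takes the value \<open>- 1\<close>.\<close>
  define c where "c = (Re (A $ p $ p) + 1) / (2 * n)"
  have h: "hermitian A" using A by (simp add: psd_def)
  define t where "t = of_real c * A $ s $ p"
  have Ap: "(A *v axis p 1) $ s = A $ s $ p" "(A *v axis p 1) $ p = A $ p $ p"
    by (simp_all add: matrix_axis)
  have sq: "cnj (A $ s $ p) * A $ s $ p = of_real n" "A $ s $ p * cnj (A $ s $ p) = of_real n"
    unfolding n_def complex_norm_square by (simp_all add: mult.commute)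
  have "cip (axis p 1 - t *s axis s 1) (A *v (axis p 1 - t *s axis s 1))
      = A $ p $ p - cnj t * A $ s $ p - t * cnj (A $ s $ p)"
    unfolding hermitian_cip_shift[OF h] by (simp add: 0 cip_axis Ap)
  also have "\<dots> = A $ p $ p - of_real (2 * c * n)"
    using sq by (simp add: t_def mult.assoc)
  also have "Re \<dots> = - 1" using n by (simp add: c_def field_simps)
  finally have "Re (cip (axis p 1 - t *s axis s 1) (A *v (axis p 1 - t *s axis s 1))) = -1" .
  moreover have "0 \<le> Re (cip (axis p 1 - t *s axis s 1) (A *v (axis p 1 - t *s axis s 1)))"
    using A unfolding psd_iff_cip by blast
  ultimately show False by linarith
qed

text \<open>The form of the complement at \<open>v\<close> is the form of \<open>A\<close> at
  \<open>v - t *s axis s 1\<close> with \<open>t = (A *v v) $ s / A $ s $ s\<close>.\<close>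

lemma psd_Schur_complement:
  fixes A :: "complex ^ 'k ^ 'k"
  assumes A: "psd A" and s: "A $ s $ s \<noteq> 0"
  shows "psd (\<chi> p q. A $ p $ q - A $ p $ s * A $ s $ q / A $ s $ s)" (is "psd ?B")
proof -
  have h: "hermitian A" using A by (simp add: psd_def)
  have cn: "cnj (A $ p $ q) = A $ q $ p" for p q using h by (metis hermitian_def)
  have "hermitian ?B" unfolding hermitian_def by (simp add: cn mult.commute)
  moreover have "0 \<le> Re (cip v (?B *v v))" for v
  proof -
    define a where "a = (A *v v) $ s"
    define t where "t = a / A $ s $ s"
    have "cip v (?B *v v) = cip v (A *v v) - (\<Sum>p\<in>UNIV. \<Sum>q\<in>UNIV. cnj (v $ p) * A $ p $ s * (A $ s $ q * v $ q)) / A $ s $ s"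
      by (simp add: cip_def matrix_vector_mult_def algebra_simps sum_subtractf sum_distrib_left sum_divide_distrib)
    also have "(\<Sum>p\<in>UNIV. \<Sum>q\<in>UNIV. cnj (v $ p) * A $ p $ s * (A $ s $ q * v $ q)) = cnj a * a"
      unfolding a_def matrix_vector_mult_def vec_lambda_beta cnj_sum sum_product by (simp add: cn mult_ac)
    also have "cip v (A *v v) - cnj a * a / A $ s $ s = cip (v - t *s axis s 1) (A *v (v - t *s axis s 1))"
      unfolding hermitian_cip_shift[OF h] a_def[symmetric] using s by (simp add: t_def cn)
    finally show ?thesis using A unfolding psd_iff_cip by auto
  qed
  ultimately show ?thesis unfolding psd_iff_cip by blast
qed

text \<open>Cholesky elimination, by induction on a set \<open>S\<close> carrying the nonzero rows.
  A nonzero pivot \<open>s\<close> contributes its normalized row as coordinate \<open>s\<close> and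
  leaves the Schur complement on the smaller set; a zero pivot has a zero row.\<close>

lemma psd_Gram_on:
  fixes A :: "complex ^ 'k ^ 'k"
  assumes "finite S" "psd A" "\<And>p q. p \<notin> S \<Longrightarrow> A $ p $ q = 0"
  shows "\<exists>w :: 'k \<Rightarrow> 'k \<Rightarrow> complex. \<forall>p q. A $ p $ q = (\<Sum>k\<in>S. cnj (w k p) * w k q)"
  using assms
proof (induction S arbitrary: A rule: finite_induct)
  case empty
  then show ?case by auto
next
  case (insert s S)
  show ?case
  proof (cases "A $ s $ s = 0")
    case True
    then have "A $ p $ q = 0" if "p \<notin> S" for p q
      using psd_zero_diag_row[OF insert.prems(1)] insert.prems(2) that by (cases "p = s") auto
    then obtain w where w: "\<And>p q. A $ p $ q = (\<Sum>k\<in>S. cnj (w k p) * w k q)"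
      using insert.IH[OF insert.prems(1)] by blast
    have "(\<Sum>k\<in>insert s S. cnj ((w(s := \<lambda>_. 0)) k p) * (w(s := \<lambda>_. 0)) k q)
        = (\<Sum>k\<in>S. cnj (w k p) * w k q)" for p q
      using insert.hyps by (auto intro!: sum.cong)
    then show ?thesis unfolding w by (intro exI[of _ "w(s := \<lambda>_. 0)"]) simp
  next
    case False
    have cn: "cnj (A $ p $ q) = A $ q $ p" for p q
      by (rule psd_cnj[OF insert.prems(1)])
    define B where "B = (\<chi> p q. A $ p $ q - A $ p $ s * A $ s $ q / A $ s $ s)"
    have "psd B" unfolding B_def by (rule psd_Schur_complement[OF insert.prems(1) False])
    moreover have "B $ p $ q = 0" if "p \<notin> S" for p q
      using that insert.prems(2)[of p] False by (cases "p = s") (auto simp: B_def)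
    ultimately obtain w where w: "\<And>p q. B $ p $ q = (\<Sum>k\<in>S. cnj (w k p) * w k q)"
      using insert.IH by blast
    define \<rho> where "\<rho> = sqrt (Re (A $ s $ s))"
    have \<rho>: "of_real \<rho> * of_real \<rho> = A $ s $ s"
      unfolding \<rho>_def by (rule psd_diag_sqrt[OF insert.prems(1)])
    define w' where "w' = w(s := \<lambda>q. A $ s $ q / of_real \<rho>)"
    have "(\<Sum>k\<in>insert s S. cnj (w' k p) * w' k q) = A $ p $ q" for p q
    proof -
      have "(\<Sum>k\<in>S. cnj (w' k p) * w' k q) = (\<Sum>k\<in>S. cnj (w k p) * w k q)"
        using insert.hyps by (auto simp: w'_def intro!: sum.cong)
      moreover have "cnj (w' s p) * w' s q = A $ p $ s * A $ s $ q / A $ s $ s"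
        by (simp add: w'_def cn \<rho>)
      moreover have "(\<Sum>k\<in>S. cnj (w k p) * w k q) = A $ p $ q - A $ p $ s * A $ s $ q / A $ s $ s"
        using w[of p q] by (simp add: B_def)
      ultimately show ?thesis using insert.hyps by simp
    qed
    then show ?thesis by (intro exI[of _ w']) simp
  qed
qed

lemma psd_Gram:
  fixes A :: "complex ^ 'k ^ 'k"
  assumes "psd A"
  obtains m :: "'k \<Rightarrow> complex ^ 'k" where "\<And>p q. A $ p $ q = cip (m p) (m q)"
proof -
  obtain w :: "'k \<Rightarrow> 'k \<Rightarrow> complex" where "\<And>p q. A $ p $ q = (\<Sum>k\<in>UNIV. cnj (w k p) * w k q)"
    using psd_Gram_on[of UNIV, OF finite assms] by auto
  then show ?thesis using that[of "\<lambda>p. \<chi> k. w k p"] by (simp add: cip_def)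
qed

lemma psd_outer_product: "psd (\<chi> p q. cnj (\<gamma> p) * \<gamma> q)"
proof -
  have eq: "(\<Sum>p\<in>UNIV. \<Sum>q\<in>UNIV. cnj (v $ p) * (cnj (\<gamma> p) * \<gamma> q) * v $ q)
      = cnj (\<Sum>p\<in>UNIV. \<gamma> p * v $ p) * (\<Sum>p\<in>UNIV. \<gamma> p * v $ p)" for v
    unfolding cnj_sum sum_product by (simp add: mult_ac)
  have "0 \<le> Re (cnj c * c)" for c by simp
  then have "0 \<le> Re (\<Sum>p\<in>UNIV. \<Sum>q\<in>UNIV. cnj (v $ p) * (cnj (\<gamma> p) * \<gamma> q) * v $ q)" for v
    unfolding eq .
  then show ?thesis unfolding psd_def hermitian_def vec_lambda_beta by (simp add: mult.commute)
qed

lemma rank_outer_product: "rank (\<chi> p q. cnj (\<gamma> p) * \<gamma> q :: complex ^ 'k ^ 'k) \<le> 1"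
proof -
  define b :: "complex ^ 'k" where "b = (\<chi> q. \<gamma> q)"
  have "row p (\<chi> p q. cnj (\<gamma> p) * \<gamma> q) = cnj (\<gamma> p) *s b" for p
    by (simp add: vec_eq_iff row_def b_def)
  then have "rows (\<chi> p q. cnj (\<gamma> p) * \<gamma> q :: complex ^ 'k ^ 'k) \<subseteq> vec.span {b}"
    by (auto simp: rows_def vec.span_singleton)
  then have "vec.dim (rows (\<chi> p q. cnj (\<gamma> p) * \<gamma> q :: complex ^ 'k ^ 'k)) \<le> card {b}"
    by (intro vec.dim_le_card) auto
  then show ?thesis by (simp add: row_rank_def_gen)
qed

text \<open>Rank at most one makes all rows multiples of one vector, so
  \<open>A $ p $ q = A $ p $ s * A $ s $ q / A $ s $ s\<close> for any nonzero pivot, and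
  \<open>\<gamma>\<close> is the normalized row \<open>s\<close>. If the diagonal is zero, so is
  \<open>A\<close>.\<close>

lemma psd_rank_le_1:
  fixes A :: "complex ^ 'k ^ 'k"
  assumes A: "psd A" and r: "rank A \<le> 1"
  obtains \<gamma> where "\<And>p q. A $ p $ q = cnj (\<gamma> p) * \<gamma> q"
proof (cases "\<forall>s. A $ s $ s = 0")
  case True
  then have "A $ p $ q = 0" for p q using psd_zero_diag_row[OF A] by blast
  then show ?thesis using that[of "\<lambda>_. 0"] by simp
next
  case False
  then obtain s where s: "A $ s $ s \<noteq> 0" by blast
  obtain B where B: "B \<subseteq> rows A" "vec.independent B" "rows A \<subseteq> vec.span B" "card B = vec.dim (rows A)"
    using vec.basis_exists[of "rows A"] by blast
  have "finite B" using B(2) by (rule vec.finiteI_independent)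
  then have "\<forall>x\<in>B. \<forall>y\<in>B. x = y"
    using B(4) r card_le_Suc0_iff_eq[of B] by (simp add: row_rank_def_gen)
  then obtain b where "B \<subseteq> {b}" by (cases "B = {}") auto
  then have "rows A \<subseteq> vec.span {b}" using B(3) vec.span_mono by blast
  then have "\<exists>c. row p A = c *s b" for p
    unfolding vec.span_singleton by (auto simp: rows_def)
  then obtain c where c: "\<And>p. row p A = c p *s b" by metis
  then have Apq: "A $ p $ q = c p * b $ q" for p q by (simp add: vec_eq_iff row_def)
  have cn: "cnj (A $ p $ q) = A $ q $ p" for p q by (rule psd_cnj[OF A])
  define \<rho> where "\<rho> = sqrt (Re (A $ s $ s))"
  have \<rho>: "of_real \<rho> * of_real \<rho> = A $ s $ s"
    unfolding \<rho>_def by (rule psd_diag_sqrt[OF A])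
  have "A $ p $ q = cnj (A $ s $ p / of_real \<rho>) * (A $ s $ q / of_real \<rho>)" for p q
  proof -
    have "cnj (A $ s $ p / of_real \<rho>) * (A $ s $ q / of_real \<rho>) = A $ p $ s * A $ s $ q / A $ s $ s"
      by (simp add: cn \<rho>)
    also have "\<dots> = A $ p $ q" using s unfolding Apq by simp
    finally show ?thesis by simp
  qed
  then show ?thesis by (rule that)
qed

text \<open>Expand \<open>1 / (1 - cnj (lam p) * lam q)\<close> as a geometric series: the
  \<open>n\<close>-th term is a congruence of \<open>A\<close> by the diagonal matrix of the
  \<open>lam p ^ n\<close>, hence positive.\<close>

lemma psd_Szego_quotient:
  fixes A :: "complex ^ 'k ^ 'k"
  assumes A: "psd A" and lam: "\<And>p. norm (lam p) < 1"
  shows "psd (\<chi> p q. A $ p $ q / (1 - cnj (lam p) * lam q))" (is "psd ?B")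
proof -
  have cn: "cnj (A $ p $ q) = A $ q $ p" for p q by (rule psd_cnj[OF A])
  have "hermitian ?B" unfolding hermitian_def by (simp add: cn mult.commute)
  moreover have "0 \<le> Re (\<Sum>p\<in>UNIV. \<Sum>q\<in>UNIV. cnj (v $ p) * ?B $ p $ q * v $ q)" for v
  proof (rule LIMSEQ_le_const)
    have "(\<lambda>N. \<Sum>n<N. (cnj (lam p) * lam q) ^ n) \<longlonglongrightarrow> 1 / (1 - cnj (lam p) * lam q)" for p q
    proof -
      have "norm (cnj (lam p) * lam q) < 1 * 1"
        unfolding norm_mult complex_mod_cnj using lam by (intro mult_strict_mono) auto
      then show ?thesis using geometric_sums[of "cnj (lam p) * lam q"] by (simp add: sums_def)
    qed
    then have "(\<lambda>N. Re (\<Sum>p\<in>UNIV. \<Sum>q\<in>UNIV. cnj (v $ p) * (A $ p $ q * (\<Sum>n<N. (cnj (lam p) * lam q) ^ n)) * v $ q))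
        \<longlonglongrightarrow> Re (\<Sum>p\<in>UNIV. \<Sum>q\<in>UNIV. cnj (v $ p) * (A $ p $ q * (1 / (1 - cnj (lam p) * lam q))) * v $ q)"
      by (intro tendsto_intros)
    then show "(\<lambda>N. Re (\<Sum>p\<in>UNIV. \<Sum>q\<in>UNIV. cnj (v $ p) * (A $ p $ q * (\<Sum>n<N. (cnj (lam p) * lam q) ^ n)) * v $ q))
        \<longlonglongrightarrow> Re (\<Sum>p\<in>UNIV. \<Sum>q\<in>UNIV. cnj (v $ p) * ?B $ p $ q * v $ q)"
      by simp
    have "0 \<le> Re (\<Sum>p\<in>UNIV. \<Sum>q\<in>UNIV. cnj (v $ p) * (A $ p $ q * (\<Sum>n<N. (cnj (lam p) * lam q) ^ n)) * v $ q)" for N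
    proof -
      have "(\<Sum>p\<in>UNIV. \<Sum>q\<in>UNIV. cnj (v $ p) * (A $ p $ q * (\<Sum>n<N. (cnj (lam p) * lam q) ^ n)) * v $ q)
        = (\<Sum>p\<in>UNIV. \<Sum>q\<in>UNIV. \<Sum>n<N. cnj ((\<chi> p. lam p ^ n * v $ p) $ p) * A $ p $ q * (\<chi> p. lam p ^ n * v $ p) $ q)"
        by (simp add: sum_distrib_left sum_distrib_right power_mult_distrib mult_ac)
      also have "\<dots> = (\<Sum>p\<in>UNIV. \<Sum>n<N. \<Sum>q\<in>UNIV. cnj ((\<chi> p. lam p ^ n * v $ p) $ p) * A $ p $ q * (\<chi> p. lam p ^ n * v $ p) $ q)"
        by (intro sum.cong refl sum.swap)
      also have "\<dots> = (\<Sum>n<N. \<Sum>p\<in>UNIV. \<Sum>q\<in>UNIV. cnj ((\<chi> p. lam p ^ n * v $ p) $ p) * A $ p $ q * (\<chi> p. lam p ^ n * v $ p) $ q)"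
        by (rule sum.swap)
      finally have eq: "(\<Sum>p\<in>UNIV. \<Sum>q\<in>UNIV. cnj (v $ p) * (A $ p $ q * (\<Sum>n<N. (cnj (lam p) * lam q) ^ n)) * v $ q)
        = (\<Sum>n<N. \<Sum>p\<in>UNIV. \<Sum>q\<in>UNIV. cnj ((\<chi> p. lam p ^ n * v $ p) $ p) * A $ p $ q * (\<chi> p. lam p ^ n * v $ p) $ q)" .
      have "0 \<le> Re (\<Sum>p\<in>UNIV. \<Sum>q\<in>UNIV. cnj (u $ p) * A $ p $ q * u $ q)" for u
        using A by (simp only: psd_def)
      then show ?thesis unfolding eq by (subst Re_sum) (rule sum_nonneg)
    qed
    then show "\<exists>N. \<forall>n\<ge>N. 0 \<le> Re (\<Sum>p\<in>UNIV. \<Sum>q\<in>UNIV. cnj (v $ p) * (A $ p $ q * (\<Sum>k<n. (cnj (lam p) * lam q) ^ k)) * v $ q)"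
      by (intro exI allI impI)
  qed
  ultimately show ?thesis unfolding psd_def by (intro conjI allI)
qed

lemma psd_add:
  fixes A B :: "complex ^ 'k ^ 'k"
  assumes "psd A" "psd B"
  shows "psd (A + B)"
proof -
  have "hermitian (A + B)"
    unfolding hermitian_def by (simp add: psd_cnj[OF assms(1)] psd_cnj[OF assms(2)])
  then show ?thesis using assms unfolding psd_iff_cip
    by (simp add: matrix_vector_mult_add_rdistrib cip_add_right)
qed

subsection \<open>The distinguished boundary\<close>

lemma analytic_several_on_const: "analytic_several_on (\<lambda>_. c) S"
  unfolding analytic_several_on_def by (intro ballI exI[of _ "\<lambda>_. 0"]) simp

lemma analytic_several_on_component: "analytic_several_on (\<lambda>x. x $ k) S"
  unfolding analytic_several_on_def
  by (intro ballI exI[of _ "\<lambda>x. x $ k"]) (simp add: bounded_linear.has_derivative[OF bounded_linear_vec_nth has_derivative_ident])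

lemma analytic_several_on_add:
  assumes "analytic_several_on f S" "analytic_several_on g S"
  shows "analytic_several_on (\<lambda>x. f x + g x) S"
  unfolding analytic_several_on_def
proof
  fix x assume x: "x \<in> S"
  obtain D where D: "(f has_derivative D) (at x)" "\<And>c v. D (c *s v) = c * D v"
    using assms(1) x unfolding analytic_several_on_def by blast
  obtain E where E: "(g has_derivative E) (at x)" "\<And>c v. E (c *s v) = c * E v"
    using assms(2) x unfolding analytic_several_on_def by blast
  show "\<exists>D. ((\<lambda>x. f x + g x) has_derivative D) (at x) \<and> (\<forall>c v. D (c *s v) = c * D v)"
    using has_derivative_add[OF D(1) E(1)] D(2) E(2)
    by (intro exI[of _ "\<lambda>h. D h + E h"]) (simp add: algebra_simps)
qed

lemma analytic_several_on_mult:
  assumes "analytic_several_on f S" "analytic_several_on g S"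
  shows "analytic_several_on (\<lambda>x. f x * g x) S"
  unfolding analytic_several_on_def
proof
  fix x assume x: "x \<in> S"
  obtain D where D: "(f has_derivative D) (at x)" "\<And>c v. D (c *s v) = c * D v"
    using assms(1) x unfolding analytic_several_on_def by blast
  obtain E where E: "(g has_derivative E) (at x)" "\<And>c v. E (c *s v) = c * E v"
    using assms(2) x unfolding analytic_several_on_def by blast
  show "\<exists>D. ((\<lambda>x. f x * g x) has_derivative D) (at x) \<and> (\<forall>c v. D (c *s v) = c * D v)"
    using has_derivative_mult[OF D(1) E(1)] D(2) E(2)
    by (intro exI[of _ "\<lambda>h. f x * E h + D h * g x"]) (simp add: algebra_simps)
qed

lemma analytic_several_on_inverse:
  assumes "analytic_several_on f S" "\<And>x. x \<in> S \<Longrightarrow> f x \<noteq> 0"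
  shows "analytic_several_on (\<lambda>x. inverse (f x)) S"
  unfolding analytic_several_on_def
proof
  fix x assume x: "x \<in> S"
  obtain D where D: "(f has_derivative D) (at x)" "\<And>c v. D (c *s v) = c * D v"
    using assms(1) x unfolding analytic_several_on_def by blast
  show "\<exists>D. ((\<lambda>x. inverse (f x)) has_derivative D) (at x) \<and> (\<forall>c v. D (c *s v) = c * D v)"
    using Deriv.has_derivative_inverse[OF assms(2)[OF x] D(1)] D(2)
    by (intro exI[of _ "\<lambda>h. - (inverse (f x) * D h * inverse (f x))"]) (simp add: algebra_simps)
qed

section \<open>Points with \<open>\<bar>x\<^sub>3\<bar> = 1\<close> as peak points and limits of
  peak points\<close>

lemma norm_Moebius_identity:
  fixes a b :: complex
  shows "(norm (1 - b * a))\<^sup>2 - (norm (cnj b - a))\<^sup>2 = (1 - (norm a)\<^sup>2) * (1 - (norm b)\<^sup>2)"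
  unfolding cmod_power2 by (simp add: power2_eq_square algebra_simps)

text \<open>A zero at \<open>(z, w)\<close> means
  \<open>1 - y\<^sub>2 w = z y\<^sub>3 (cnj y\<^sub>2 - w)\<close>. As \<open>\<bar>cnj y\<^sub>2 -
  w\<bar> \<le> \<bar>1 - y\<^sub>2 w\<bar>\<close> and \<open>\<bar>z\<bar> < 1\<close>, this
  forces \<open>y\<^sub>2 w = 1\<close>, which is impossible.\<close>

lemma toral_point_in_closed_tetrablock:
  fixes y :: "complex ^ 3"
  assumes y: "norm (y $ 3) = 1" "y $ 1 = cnj (y $ 2) * y $ 3" "norm (y $ 2) \<le> 1"
  shows "y \<in> closed_tetrablock"
  unfolding closed_tetrablock_def
proof (intro CollectI ballI notI)
  fix z w :: complex
  assume "z \<in> ball 0 1" "w \<in> ball 0 1"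
    and 0: "1 - y $ 1 * z - y $ 2 * w + y $ 3 * z * w = 0"
  then have z: "norm z < 1" and w: "norm w < 1" by auto
  have w2: "0 \<le> 1 - (norm w)\<^sup>2" and y2: "0 \<le> 1 - (norm (y $ 2))\<^sup>2"
    using w y(3) by (simp_all add: power_le_one)
  have "(norm (cnj (y $ 2) - w))\<^sup>2 \<le> (norm (1 - y $ 2 * w))\<^sup>2"
    using norm_Moebius_identity[of "y $ 2" w] mult_nonneg_nonneg[OF w2 y2] by linarith
  then have le: "norm (cnj (y $ 2) - w) \<le> norm (1 - y $ 2 * w)" by simp
  have "1 - y $ 2 * w = z * (y $ 3 * (cnj (y $ 2) - w))"
    using 0 unfolding y(2) by (simp add: algebra_simps)
  then have "norm (1 - y $ 2 * w) = norm z * norm (cnj (y $ 2) - w)"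
    by (simp add: norm_mult y(1))
  also have "\<dots> \<le> norm z * norm (1 - y $ 2 * w)" using le by (intro mult_left_mono) auto
  finally have "norm (1 - y $ 2 * w) = 0" using z by (simp add: mult_le_cancel_right1)
  then have "norm (y $ 2 * w) = 1" by (metis eq_iff_diff_eq_0 norm_eq_zero norm_one)
  moreover have "norm (y $ 2 * w) \<le> 1 * norm w" unfolding norm_mult using y(3) by (intro mult_right_mono) auto
  ultimately show False using w by simp
qed

text \<open>With a square root \<open>f\<close> of \<open>x\<^sub>1 x\<^sub>2 - x\<^sub>3\<close> in
  both off-diagonal places the matrix is contractive; the bound is that of its second
  column.\<close>

lemma tetra_det_bound:
  fixes x :: "complex ^ 3"
  assumes x: "x \<in> closed_tetrablock"
  shows "norm (x $ 1 * x $ 2 - x $ 3) \<le> 1 - (norm (x $ 2))\<^sup>2"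
proof -
  define f where "f = csqrt (x $ 1 * x $ 2 - x $ 3)"
  have ff: "f * f = x $ 1 * x $ 2 - x $ 3" by (simp add: f_def flip: power2_eq_square)
  have n: "(norm f)\<^sup>2 = norm (x $ 1 * x $ 2 - x $ 3)"
    unfolding ff[symmetric] by (simp add: norm_mult power2_eq_square)
  have "contraction2 (x $ 1) f f (x $ 2)"
    by (rule tetra_contraction2[OF closed_tetrablockD[OF x] ff refl])
  from this[unfolded contraction2_def, rule_format, of 0 1]
  have "(norm f)\<^sup>2 + (norm (x $ 2))\<^sup>2 \<le> 1" by simp
  then show ?thesis using n by simp
qed

text \<open>The peak function at \<open>y\<close> comes from the Schwarz--Pick lemma: \<open>\<Psi>(\<cdot>, x)\<close> is a self-map of
  the disc with derivative \<open>(x\<^sub>1 x\<^sub>2 - x\<^sub>3) / (1 - a x\<^sub>2)\<^sup>2\<close> at \<open>a\<close>, the derivative is largest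
  for automorphisms vanishing at \<open>a\<close>, and \<open>a = cnj y\<^sub>2\<close> is the zero of \<open>\<Psi>(\<cdot>, y)\<close>.\<close>
lemma tetra_peak:
  fixes x y :: "complex ^ 3"
  assumes y: "norm (y $ 3) = 1" "y $ 1 = cnj (y $ 2) * y $ 3" "norm (y $ 2) < 1"
    and x: "x \<in> closed_tetrablock"
  defines "f \<equiv> \<lambda>x :: complex ^ 3. (x $ 1 * x $ 2 - x $ 3) * inverse ((1 - cnj (y $ 2) * x $ 2)\<^sup>2) * (1 + cnj (y $ 3) * x $ 3)"
  assumes ge: "norm (f y) \<le> norm (f x)"
  shows "x = y"
proof -
  define a where "a = cnj (y $ 2)"
  define b where "b = x $ 2"
  define v where "v = norm (x $ 1 * x $ 2 - x $ 3)"
  note nz = closed_tetrablockD[OF x]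
  have na: "norm a < 1" using y(3) by (simp add: a_def)
  then have a1: "0 < 1 - (norm a)\<^sup>2" by (simp add: abs_square_less_1)
  note m = tetra_moduli[of "x $ 1" "x $ 2" "x $ 3", OF nz]
  have v: "v \<le> 1 - (norm b)\<^sup>2" using tetra_det_bound[OF x] by (simp add: v_def b_def)
  have id: "(norm (1 - b * a))\<^sup>2 - (norm (cnj b - a))\<^sup>2 = (1 - (norm a)\<^sup>2) * (1 - (norm b)\<^sup>2)"
    by (rule norm_Moebius_identity)
  have "norm b * norm a \<le> 1 * norm a" using m(2) by (intro mult_right_mono) (simp_all add: b_def)
  then have "norm (b * a) < 1" using na by (simp add: norm_mult)
  then have "1 - b * a \<noteq> 0" by auto
  then have den: "0 < (norm (1 - b * a))\<^sup>2" by simp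
  \<comment> \<open>The derivative alone does not see the phase of \<open>x\<^sub>3\<close>; on the
    closed disc this factor reaches modulus \<open>2\<close> only at
    \<open>x\<^sub>3 = y\<^sub>3\<close>.\<close>
  have t: "norm (1 + cnj (y $ 3) * x $ 3) \<le> 2"
    using norm_triangle_ineq[of 1 "cnj (y $ 3) * x $ 3"] m(3) by (simp add: norm_mult y(1))
  have fx: "norm (f x) = v / (norm (1 - b * a))\<^sup>2 * norm (1 + cnj (y $ 3) * x $ 3)"
    by (simp add: f_def v_def a_def b_def norm_mult norm_inverse norm_power mult.commute divide_inverse)
  have yy: "y $ 2 * a = of_real ((norm a)\<^sup>2)" "y $ 3 * cnj (y $ 3) = 1"
    using complex_norm_square[of "y $ 2"] complex_norm_square[of "y $ 3"] y(1) by (simp_all add: a_def)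
  have fy: "norm (f y) = 2 / (1 - (norm a)\<^sup>2)"
  proof -
    have "y $ 1 * y $ 2 - y $ 3 = - (of_real (1 - (norm a)\<^sup>2) * y $ 3)"
      using yy(1) unfolding y(2) a_def by (simp add: algebra_simps)
    then have n: "norm (y $ 1 * y $ 2 - y $ 3) = 1 - (norm a)\<^sup>2"
      using a1 y(1) by (simp only: norm_minus_cancel norm_mult norm_of_real) simp
    have "1 - cnj (y $ 2) * y $ 2 = of_real (1 - (norm a)\<^sup>2)"
      using yy(1) by (simp add: a_def mult.commute)
    then have d: "norm (1 - cnj (y $ 2) * y $ 2) = 1 - (norm a)\<^sup>2"
      using a1 by (metis abs_of_pos norm_of_real)
    have "norm (1 + cnj (y $ 3) * y $ 3) = 2" using yy(2) by (simp add: mult.commute)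
    moreover have "A * inverse (A\<^sup>2) * 2 = 2 / A" if "A \<noteq> 0" for A :: real
      using that by (simp add: power2_eq_square field_simps)
    ultimately show ?thesis using a1
      unfolding f_def norm_mult norm_inverse norm_power n d by simp
  qed
  \<comment> \<open>Schwarz-Pick with its error term: equality in the peak estimate forces
    \<open>cnj b = a\<close>.\<close>
  have u: "v * (1 - (norm a)\<^sup>2) \<le> (norm (1 - b * a))\<^sup>2 - (norm (cnj b - a))\<^sup>2"
    unfolding id using v a1 by (simp add: mult.commute)
  define k where "k = norm (1 + cnj (y $ 3) * x $ 3)"
  have k: "0 \<le> k" "k \<le> 2" using t by (auto simp: k_def)
  have v0: "0 \<le> v" by (simp add: v_def)
  have "2 / (1 - (norm a)\<^sup>2) \<le> v / (norm (1 - b * a))\<^sup>2 * k" using ge unfolding fx fy k_def .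
  then have main: "2 * (norm (1 - b * a))\<^sup>2 \<le> v * (1 - (norm a)\<^sup>2) * k"
    using a1 den by (simp add: field_simps)
  have "v * (1 - (norm a)\<^sup>2) * k \<le> v * (1 - (norm a)\<^sup>2) * 2"
    using k v0 a1 by (intro mult_left_mono) auto
  then have "2 * (norm (cnj b - a))\<^sup>2 \<le> 0" using main u by linarith
  then have ba: "cnj b = a" by simp
  then have nb: "norm b = norm a" by (metis complex_mod_cnj)
  have D: "(norm (1 - b * a))\<^sup>2 = (1 - (norm a)\<^sup>2) * (1 - (norm a)\<^sup>2)"
    using id by (simp add: ba nb)
  have "2 * (1 - (norm a)\<^sup>2) \<le> v * k"
    using main a1 unfolding D by (simp add: mult_ac)
  moreover have "v * k \<le> v * 2" using k v0 by (intro mult_left_mono)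
  ultimately have veq: "v = 1 - (norm a)\<^sup>2" and keq: "v * 2 \<le> v * k" using v nb by auto
  have "0 < v" using veq a1 by simp
  then have "2 \<le> k" using keq by (simp only: mult_le_cancel_left_pos)
  then have k2: "k = 2" using k by simp
  have nz': "1 - x $ 2 * z - x $ 1 * w + x $ 3 * z * w \<noteq> 0" if "norm z < 1" "norm w < 1" for z w
    using nz[OF that(2,1)] by (simp add: algebra_simps)
  note E2 = tetra_modulus_ineq[of "x $ 2" "x $ 1" "x $ 3", OF nz']
  have nn: "norm (x $ 2) = norm a" using nb by (simp add: b_def)
  \<comment> \<open>Once \<open>v\<close> is extremal, the sum of the two modulus inequalities
    leaves no room for this term.\<close>
  have "norm (x $ 1 - cnj (x $ 2) * x $ 3) \<le> 0"
    using m(4) E2 veq unfolding v_def nn by linarith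
  then have x1: "x $ 1 = cnj (x $ 2) * x $ 3" by simp
  have x2: "x $ 2 = y $ 2" using ba by (simp add: a_def b_def)
  define c where "c = cnj (y $ 3) * x $ 3"
  have nc: "norm c \<le> 1" using m(3) y(1) by (simp add: c_def norm_mult)
  have "(norm (1 + c))\<^sup>2 = 1 + (norm c)\<^sup>2 + 2 * Re c"
    unfolding cmod_power2 by (simp add: power2_eq_square algebra_simps)
  moreover have "norm (1 + c) = 2" using k2 by (simp add: k_def c_def)
  moreover have "(norm c)\<^sup>2 \<le> 1" using nc by (simp add: power_le_one)
  ultimately have "1 \<le> Re c" by simp
  moreover have "(Re c)\<^sup>2 + (Im c)\<^sup>2 \<le> 1" using \<open>(norm c)\<^sup>2 \<le> 1\<close> by (simp add: cmod_power2)
  moreover have "Re c \<le> 1" using nc complex_Re_le_cmod[of c] by linarith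
  ultimately have "c = 1" by (simp add: complex_eq_iff)
  then have "y $ 3 * (cnj (y $ 3) * x $ 3) = y $ 3" by (simp add: c_def)
  then have "x $ 3 = y $ 3" using yy(2) by (simp add: mult.assoc[symmetric])
  with x1 x2 y(2) show ?thesis by (simp add: vec_eq_iff forall_3)
qed

text \<open>The maximum over \<open>F\<close> of the modulus of the peak function is at least its
  value at \<open>y\<close>, and \<open>tetra_peak\<close> allows this at \<open>y\<close>
  alone.\<close>

lemma toral_point_in_closed_boundary:
  fixes y :: "complex ^ 3"
  assumes F: "closed_boundary tetrablock_algebra closed_tetrablock F"
    and y: "norm (y $ 3) = 1" "y $ 1 = cnj (y $ 2) * y $ 3" "norm (y $ 2) < 1"
  shows "y \<in> F"
proof -
  define f where "f = (\<lambda>x :: complex ^ 3. (x $ 1 * x $ 2 - x $ 3) * inverse ((1 - cnj (y $ 2) * x $ 2)\<^sup>2) * (1 + cnj (y $ 3) * x $ 3))"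
  have "continuous_on closed_tetrablock f"
    unfolding f_def
  proof (intro continuous_intros ballI)
    fix x :: "complex ^ 3" assume "x \<in> closed_tetrablock"
    then have "x $ 2 * cnj (y $ 2) \<noteq> 1" using closed_tetrablock_denom_ne y(3) by simp
    then show "(1 - cnj (y $ 2) * x $ 2)\<^sup>2 \<noteq> 0" by (simp add: mult.commute)
  qed
  moreover have "analytic_several_on f tetrablock"
  proof -
    have ne: "(1 + (- cnj (y $ 2)) * x $ 2) * (1 + (- cnj (y $ 2)) * x $ 2) \<noteq> 0" if "x \<in> tetrablock" for x :: "complex ^ 3"
    proof -
      have "1 - x $ 1 * 0 - x $ 2 * cnj (y $ 2) + x $ 3 * 0 * cnj (y $ 2) \<noteq> 0"
        using that[unfolded tetrablock_def, THEN CollectD, THEN bspec, of 0, THEN bspec, of "cnj (y $ 2)"] y(3)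
        by simp
      then show ?thesis by (simp add: mult.commute)
    qed
    \<comment> \<open>Differences and the square are rewritten as sums and products, to match the
      closure rules for analyticity.\<close>
    have eq: "f = (\<lambda>x. (x $ 1 * x $ 2 + (- 1) * x $ 3) *
        inverse ((1 + (- cnj (y $ 2)) * x $ 2) * (1 + (- cnj (y $ 2)) * x $ 2)) * (1 + cnj (y $ 3) * x $ 3))"
      by (simp add: f_def power2_eq_square)
    show ?thesis unfolding eq
      by (intro analytic_several_on_mult analytic_several_on_add analytic_several_on_inverse
          analytic_several_on_const analytic_several_on_component ne)
  qed
  ultimately have "f \<in> tetrablock_algebra" by (simp add: tetrablock_algebra_def)
  then obtain p where p: "p \<in> F" "\<And>x. x \<in> closed_tetrablock \<Longrightarrow> norm (f x) \<le> norm (f p)" and FX: "F \<subseteq> closed_tetrablock"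
    using F unfolding closed_boundary_def by blast
  have "y \<in> closed_tetrablock" using toral_point_in_closed_tetrablock y by simp
  then have "norm (f y) \<le> norm (f p)" by (rule p(2))
  then have "p = y" using tetra_peak[OF y, of p] p(1) FX unfolding f_def by blast
  then show ?thesis using p(1) by simp
qed

text \<open>Shrinking the first two coordinates by \<open>t < 1\<close> preserves
  \<open>y\<^sub>1 = cnj y\<^sub>2 * y\<^sub>3\<close> and gives
  \<open>\<bar>y\<^sub>2\<bar> < 1\<close>; closedness of \<open>F\<close> then covers
  \<open>\<bar>y\<^sub>2\<bar> = 1\<close>.\<close>

lemma toral_point_in_distinguished_boundary:
  fixes y :: "complex ^ 3"
  assumes y: "norm (y $ 3) = 1" "y $ 1 = cnj (y $ 2) * y $ 3" "norm (y $ 2) \<le> 1"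
  shows "y \<in> distinguished_boundary"
  unfolding distinguished_boundary_def shilov_boundary_def
proof (intro InterI, clarify)
  fix F assume F: "closed_boundary tetrablock_algebra closed_tetrablock F"
  define t where "t m = 1 - 1 / (real m + 2)" for m
  have t: "0 \<le> t m" "t m < 1" for m by (auto simp: t_def)
  have tl: "t \<longlonglongrightarrow> 1" unfolding t_def by real_asymp
  define Y :: "nat \<Rightarrow> complex ^ 3" where "Y m = vector [of_real (t m) * y $ 1, of_real (t m) * y $ 2, y $ 3]" for m
  have "Y m \<in> F" for m
  proof (rule toral_point_in_closed_boundary[OF F])
    have "norm (of_real (t m) * y $ 2) = t m * norm (y $ 2)"
      using t(1)[of m] by (simp add: norm_mult)
    also have "\<dots> \<le> t m * 1" using t(1) y(3) by (intro mult_left_mono)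
    finally show "norm (Y m $ 2) < 1" using t(2)[of m] by (simp add: Y_def)
  qed (simp_all add: Y_def y)
  moreover have "Y \<longlonglongrightarrow> y"
  proof (rule vec_tendstoI)
    fix k :: 3
    have "(\<lambda>m. of_real (t m) * c) \<longlonglongrightarrow> c" for c :: complex
      using tendsto_mult_right[OF tendsto_of_real[OF tl], of c] by simp
    then show "(\<lambda>m. Y m $ k) \<longlonglongrightarrow> y $ k"
      using exhaust_3[of k] by (auto simp: Y_def)
  qed
  moreover have "closed F" using F by (simp add: closed_boundary_def)
  ultimately show "y \<in> F" using closed_sequentially by blast
qed

subsection \<open>Transfer functions\<close>

text \<open>Polynomials as functions: closure under determinants turns Cramer's rule into polynomial
  numerators and denominators.\<close>

definition polyfun :: "(complex \<Rightarrow> complex) \<Rightarrow> bool" where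
  "polyfun f \<longleftrightarrow> (\<exists>p. \<forall>s. f s = poly p s)"

lemma polyfun_const: "polyfun (\<lambda>_. c)"
  unfolding polyfun_def by (intro exI[of _ "[:c:]"]) simp

lemma polyfun_id: "polyfun (\<lambda>s. s)"
  unfolding polyfun_def by (intro exI[of _ "[:0, 1:]"]) simp

lemma polyfun_add: "polyfun f \<Longrightarrow> polyfun g \<Longrightarrow> polyfun (\<lambda>s. f s + g s)"
  unfolding polyfun_def by (metis poly_add)

lemma polyfun_mult: "polyfun f \<Longrightarrow> polyfun g \<Longrightarrow> polyfun (\<lambda>s. f s * g s)"
  unfolding polyfun_def by (metis poly_mult)

lemma polyfun_diff: "polyfun f \<Longrightarrow> polyfun g \<Longrightarrow> polyfun (\<lambda>s. f s - g s)"
  unfolding polyfun_def by (metis poly_diff)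

lemma polyfun_sum: "(\<And>i. i \<in> I \<Longrightarrow> polyfun (f i)) \<Longrightarrow> polyfun (\<lambda>s. \<Sum>i\<in>I. f i s)"
  by (induction I rule: infinite_finite_induct) (auto intro: polyfun_const polyfun_add)

lemma polyfun_prod: "(\<And>i. i \<in> I \<Longrightarrow> polyfun (f i)) \<Longrightarrow> polyfun (\<lambda>s. \<Prod>i\<in>I. f i s)"
  by (induction I rule: infinite_finite_induct) (auto intro: polyfun_const polyfun_mult)

lemma polyfun_det: "(\<And>i j. polyfun (\<lambda>s. A s $ i $ j)) \<Longrightarrow> polyfun (\<lambda>s. det (A s))"
  unfolding det_def by (intro polyfun_sum polyfun_mult polyfun_prod polyfun_const)

text \<open>For \<open>L = [A, B; C, D]\<close> on \<open>\<complex>\<^sup>2 \<oplus> \<complex>\<^sup>p\<close>, with \<open>bool\<close> indexing \<open>\<complex>\<^sup>2\<close>, the \<open>Inl\<close> part of the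
  solution of \<open>w = L (\<alpha>, \<beta>, s w)\<close> is \<open>(A + s B (1 - s D)\<^sup>-\<^sup>1 C) (\<alpha>, \<beta>)\<close>.\<close>
definition feedback_input :: "complex \<Rightarrow> complex \<Rightarrow> complex \<Rightarrow> complex ^ (bool + 'p::finite) \<Rightarrow> complex ^ (bool + 'p)" where
  "feedback_input \<alpha> \<beta> s w = (\<chi> i. case i of Inl b \<Rightarrow> if b then \<beta> else \<alpha> | Inr p \<Rightarrow> s * w $ Inr p)"

lemma sum_UNIV_bool_plus:
  fixes f :: "bool + 'p::finite \<Rightarrow> 'a::comm_monoid_add"
  shows "(\<Sum>i\<in>UNIV. f i) = f (Inl False) + f (Inl True) + (\<Sum>p\<in>UNIV. f (Inr p))"
proof -
  have "(\<Sum>i\<in>UNIV. f i) = sum (f \<circ> Inl) UNIV + sum (f \<circ> Inr) UNIV"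
    unfolding UNIV_Plus_UNIV[symmetric] by (rule sum.Plus) auto
  then show ?thesis by (simp add: UNIV_bool add.commute)
qed

lemma norm_sq_bool_plus:
  fixes w :: "complex ^ (bool + 'p::finite)"
  shows "(norm w)\<^sup>2 = (norm (w $ Inl False))\<^sup>2 + (norm (w $ Inl True))\<^sup>2 + (\<Sum>p\<in>UNIV. (norm (w $ Inr p))\<^sup>2)"
  by (simp add: norm_vec_def L2_set_def sum_nonneg sum_UNIV_bool_plus)

lemma norm_sq_feedback_input:
  fixes w :: "complex ^ (bool + 'p::finite)"
  shows "(norm (feedback_input \<alpha> \<beta> s w))\<^sup>2
    = (norm \<alpha>)\<^sup>2 + (norm \<beta>)\<^sup>2 + (norm s)\<^sup>2 * (\<Sum>p\<in>UNIV. (norm (w $ Inr p))\<^sup>2)"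
  by (simp add: norm_sq_bool_plus feedback_input_def norm_mult power_mult_distrib sum_distrib_left)

text \<open>Cramer's rule gives the transfer function with common denominator
  \<open>q = det T\<close>. Unitarity of \<open>L\<close> gives the energy balance
  \<open>\<bar>output\<bar>^2 + S = \<bar>input\<bar>^2 + \<bar>s\<bar>^2 * S\<close>, where
  \<open>S\<close> is the squared length of the state; contractivity on the closed disc and isometry
  on the circle, off the zeros of \<open>q\<close>, follow.\<close>

lemma transfer_function_realization:
  fixes L :: "complex ^ (bool + 'p::finite) ^ (bool + 'p)"
  assumes L: "cunitary L"
  obtains q :: "complex poly" and P :: "bool \<Rightarrow> bool \<Rightarrow> complex poly" where
    "\<And>s. norm s < 1 \<Longrightarrow> poly q s \<noteq> 0"
    "\<And>s. norm s \<le> 1 \<Longrightarrow> poly q s \<noteq> 0 \<Longrightarrow>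
      contraction2 (poly (P False False) s / poly q s) (poly (P False True) s / poly q s)
        (poly (P True False) s / poly q s) (poly (P True True) s / poly q s)"
    "\<And>s \<alpha> \<beta>. norm s = 1 \<Longrightarrow> poly q s \<noteq> 0 \<Longrightarrow>
      (norm (poly (P False False) s / poly q s * \<alpha> + poly (P False True) s / poly q s * \<beta>))\<^sup>2
      + (norm (poly (P True False) s / poly q s * \<alpha> + poly (P True True) s / poly q s * \<beta>))\<^sup>2
      = (norm \<alpha>)\<^sup>2 + (norm \<beta>)\<^sup>2"
    "\<And>s \<alpha> \<beta> w i. norm s < 1 \<Longrightarrow> w = L *v feedback_input \<alpha> \<beta> s w \<Longrightarrow>
      w $ Inl i = poly (P i False) s / poly q s * \<alpha> + poly (P i True) s / poly q s * \<beta>"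
proof -
  \<comment> \<open>Only the \<open>Inr\<close> columns of \<open>L\<close> are fed back, so
    \<open>w = L *v feedback_input \<alpha> \<beta> s w\<close> becomes a linear system with matrix
    \<open>T s\<close> and the \<open>Inl\<close> columns on the right.\<close>
  define T :: "complex \<Rightarrow> complex ^ (bool + 'p) ^ (bool + 'p)" where
    "T s = (\<chi> i j. (if i = j then 1 else 0) - s * (case j of Inl _ \<Rightarrow> 0 | Inr _ \<Rightarrow> L $ i $ j))" for s
  define c where "c b = (\<chi> i. L $ i $ Inl b)" for b
  define M :: "bool + 'p \<Rightarrow> bool \<Rightarrow> complex \<Rightarrow> complex ^ (bool + 'p) ^ (bool + 'p)" where
    "M k b s = (\<chi> i j. if j = k then c b $ i else T s $ i $ j)" for k b s
  have Tp: "polyfun (\<lambda>s. T s $ i $ j)" for i j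
    unfolding T_def vec_lambda_beta by (intro polyfun_diff polyfun_mult polyfun_id polyfun_const)
  then have "polyfun (\<lambda>s. det (T s))" by (rule polyfun_det)
  then obtain q where q: "\<And>s. det (T s) = poly q s" unfolding polyfun_def by blast
  have "polyfun (\<lambda>s. M k b s $ i $ j)" for k b i j
    unfolding M_def vec_lambda_beta using Tp polyfun_const by (cases "j = k") simp_all
  then have "polyfun (\<lambda>s. det (M k b s))" for k b by (rule polyfun_det)
  then have ex: "\<exists>p. \<forall>s. det (M k b s) = poly p s" for k b unfolding polyfun_def .
  define P where "P i b = (SOME p. \<forall>s. det (M (Inl i) b s) = poly p s)" for i b
  have P: "det (M (Inl i) b s) = poly (P i b) s" for i b s
    unfolding P_def using someI_ex[OF ex] by blast
  have fix_iff: "w = L *v feedback_input \<alpha> \<beta> s w \<longleftrightarrow> T s *v w = \<alpha> *s c False + \<beta> *s c True" for w \<alpha> \<beta> s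
  proof -
    have l: "(L *v feedback_input \<alpha> \<beta> s w) $ i = L $ i $ Inl False * \<alpha> + L $ i $ Inl True * \<beta>
        + s * (\<Sum>p\<in>UNIV. L $ i $ Inr p * w $ Inr p)" for i
      by (simp add: matrix_vector_mult_def feedback_input_def sum_UNIV_bool_plus sum_distrib_left mult_ac)
    have r: "(T s *v w) $ i = w $ i - s * (\<Sum>p\<in>UNIV. L $ i $ Inr p * w $ Inr p)" for i
    proof -
      have "(T s *v w) $ i = (\<Sum>j\<in>UNIV. (if i = j then w $ j else 0))
          - (\<Sum>j\<in>UNIV. s * (case j of Inl _ \<Rightarrow> 0 | Inr _ \<Rightarrow> L $ i $ j) * w $ j)"
        unfolding sum_subtractf[symmetric]
        by (auto simp: matrix_vector_mult_def T_def algebra_simps intro!: sum.cong)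
      also have "(\<Sum>j\<in>UNIV. s * (case j of Inl _ \<Rightarrow> 0 | Inr _ \<Rightarrow> L $ i $ j) * w $ j)
          = s * (\<Sum>p\<in>UNIV. L $ i $ Inr p * w $ Inr p)"
        by (simp add: sum_UNIV_bool_plus sum_distrib_left mult_ac)
      finally show ?thesis by simp
    qed
    show ?thesis
      unfolding vec_eq_iff l r by (simp add: c_def diff_eq_eq mult.commute[of \<alpha>] mult.commute[of \<beta>])
  qed
  have q_ne: "poly q s \<noteq> 0" if s: "norm s < 1" for s
  proof -
    \<comment> \<open>With zero input the energy balance reads
      \<open>(norm w)\<^sup>2 = (norm s)\<^sup>2 * S\<close>, and
      \<open>S \<le> (norm w)\<^sup>2\<close>.\<close>
    have "w = 0" if "T s *v w = 0" for w
    proof -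
      define S where "S = (\<Sum>p\<in>UNIV. (norm (w $ Inr p))\<^sup>2)"
      have "w = L *v feedback_input 0 0 s w" using that by (simp add: fix_iff)
      from arg_cong[OF this, of norm] have "norm w = norm (feedback_input 0 0 s w)"
        by (simp only: cunitary_norm[OF L])
      then have "(norm w)\<^sup>2 = (norm s)\<^sup>2 * S" using norm_sq_feedback_input[of 0 0 s w] by (simp add: S_def)
      moreover have "S \<le> (norm w)\<^sup>2" unfolding S_def norm_sq_bool_plus by simp
      then have "(norm s)\<^sup>2 * S \<le> (norm s)\<^sup>2 * (norm w)\<^sup>2" by (intro mult_left_mono) auto
      moreover have "(norm s)\<^sup>2 < 1" using s by (simp add: abs_square_less_1)
      ultimately have "(1 - (norm s)\<^sup>2) * (norm w)\<^sup>2 \<le> 0" "0 < 1 - (norm s)\<^sup>2"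
        by (simp_all add: algebra_simps)
      then have "(norm w)\<^sup>2 \<le> 0" by (simp only: mult_le_0_iff) simp
      then show ?thesis by simp
    qed
    then have "\<exists>B. B ** T s = mat 1" unfolding matrix_left_invertible_ker by blast
    then have "invertible (T s)" unfolding invertible_def using matrix_left_right_inverse by blast
    then show ?thesis by (simp add: invertible_det_nz q)
  qed
  have solution: "T s *v w = \<alpha> *s c False + \<beta> *s c True \<longleftrightarrow>
      w = (\<chi> k. det (M k False s) / poly q s * \<alpha> + det (M k True s) / poly q s * \<beta>)"
    if "poly q s \<noteq> 0" for s w \<alpha> \<beta>
  proof -
    have d: "det (T s) \<noteq> 0" using that q by simp
    have W: "T s *v (\<chi> k. det (M k b s) / poly q s) = c b" for b
      unfolding cramer[OF d] by (simp add: M_def q)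
    have eq: "(\<chi> k. det (M k False s) / poly q s * \<alpha> + det (M k True s) / poly q s * \<beta>)
        = \<alpha> *s (\<chi> k. det (M k False s) / poly q s) + \<beta> *s (\<chi> k. det (M k True s) / poly q s)"
      by (simp add: vec_eq_iff mult.commute)
    have "T s *v (\<alpha> *s (\<chi> k. det (M k False s) / poly q s) + \<beta> *s (\<chi> k. det (M k True s) / poly q s))
       = \<alpha> *s c False + \<beta> *s c True"
      by (simp add: matrix_vector_right_distrib vector_scalar_commute W)
    \<comment> \<open>Here \<open>cramer\<close> supplies uniqueness; the solution itself was found
      by superposition.\<close>
    moreover have "\<exists>v. \<forall>x. T s *v x = \<alpha> *s c False + \<beta> *s c True \<longleftrightarrow> x = v"
      by (intro exI allI, rule cramer[OF d])
    then obtain v where "\<And>x. T s *v x = \<alpha> *s c False + \<beta> *s c True \<longleftrightarrow> x = v" by blast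
    ultimately show ?thesis unfolding eq by simp
  qed
  have energy: "(norm (poly (P False False) s / poly q s * \<alpha> + poly (P False True) s / poly q s * \<beta>))\<^sup>2
      + (norm (poly (P True False) s / poly q s * \<alpha> + poly (P True True) s / poly q s * \<beta>))\<^sup>2
      + S = (norm \<alpha>)\<^sup>2 + (norm \<beta>)\<^sup>2 + (norm s)\<^sup>2 * S \<and> 0 \<le> S"
    if "poly q s \<noteq> 0" and "S = (\<Sum>p\<in>UNIV. (norm (det (M (Inr p) False s) / poly q s * \<alpha> + det (M (Inr p) True s) / poly q s * \<beta>))\<^sup>2)"
    for s \<alpha> \<beta> S
  proof -
    define w where "w = (\<chi> k. det (M k False s) / poly q s * \<alpha> + det (M k True s) / poly q s * \<beta>)"
    have "w = L *v feedback_input \<alpha> \<beta> s w"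
      unfolding fix_iff solution[OF that(1)] w_def ..
    from arg_cong[OF this, of norm] have "norm w = norm (feedback_input \<alpha> \<beta> s w)"
      by (simp only: cunitary_norm[OF L])
    then have "(norm w)\<^sup>2 = (norm \<alpha>)\<^sup>2 + (norm \<beta>)\<^sup>2 + (norm s)\<^sup>2 * (\<Sum>p\<in>UNIV. (norm (w $ Inr p))\<^sup>2)"
      unfolding norm_sq_feedback_input[symmetric] by simp
    then show ?thesis unfolding norm_sq_bool_plus that(2)
      by (simp add: w_def P sum_nonneg)
  qed
  show ?thesis
  proof (rule that[of q P])
    show "poly q s \<noteq> 0" if "norm s < 1" for s using q_ne that .
  next
    fix s :: complex assume s: "norm s \<le> 1" "poly q s \<noteq> 0"
    show "contraction2 (poly (P False False) s / poly q s) (poly (P False True) s / poly q s)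
        (poly (P True False) s / poly q s) (poly (P True True) s / poly q s)"
      unfolding contraction2_def
    proof (intro allI)
      fix \<alpha> \<beta> :: complex
      define S where "S = (\<Sum>p\<in>UNIV. (norm (det (M (Inr p) False s) / poly q s * \<alpha> + det (M (Inr p) True s) / poly q s * \<beta>))\<^sup>2)"
      note E = energy[OF s(2) S_def]
      have "(norm s)\<^sup>2 * S \<le> 1 * S"
        using s(1) E by (intro mult_right_mono) (auto simp: power_le_one)
      then show "(norm (poly (P False False) s / poly q s * \<alpha> + poly (P False True) s / poly q s * \<beta>))\<^sup>2
          + (norm (poly (P True False) s / poly q s * \<alpha> + poly (P True True) s / poly q s * \<beta>))\<^sup>2
          \<le> (norm \<alpha>)\<^sup>2 + (norm \<beta>)\<^sup>2"
        using E by linarith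
    qed
  next
    fix s \<alpha> \<beta> :: complex assume "norm s = 1" "poly q s \<noteq> 0"
    then show "(norm (poly (P False False) s / poly q s * \<alpha> + poly (P False True) s / poly q s * \<beta>))\<^sup>2
      + (norm (poly (P True False) s / poly q s * \<alpha> + poly (P True True) s / poly q s * \<beta>))\<^sup>2
      = (norm \<alpha>)\<^sup>2 + (norm \<beta>)\<^sup>2"
      using energy[OF _ refl, of s \<alpha> \<beta>] by simp
  next
    fix s \<alpha> \<beta> w i assume "norm s < 1" "w = L *v feedback_input \<alpha> \<beta> s w"
    then show "w $ Inl i = poly (P i False) s / poly q s * \<alpha> + poly (P i True) s / poly q s * \<beta>"
      unfolding fix_iff solution[OF q_ne[OF \<open>norm s < 1\<close>]] by (simp add: P)
  qed
qed

subsection \<open>Rational inner interpolants\<close>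

text \<open>\<open>Arg2pi\<close> recovers \<open>t\<close> from \<open>cis t\<close> on the
  half-open interval, so the endpoint \<open>2 * pi\<close> is added separately.\<close>

lemma finite_roots_on_circle:
  fixes q :: "complex poly"
  assumes "q \<noteq> 0"
  shows "finite {t \<in> {0..2 * pi}. poly q (cis t) = 0}"
proof -
  have "{t \<in> {0..2 * pi}. poly q (cis t) = 0} \<subseteq> insert (2 * pi) (Arg2pi ` {s. poly q s = 0})"
  proof
    fix t assume t: "t \<in> {t \<in> {0..2 * pi}. poly q (cis t) = 0}"
    show "t \<in> insert (2 * pi) (Arg2pi ` {s. poly q s = 0})"
    proof (cases "t = 2 * pi")
      case False
      then have "Arg2pi (cis t) = t"
        using t by (intro Arg2pi_unique[of 1]) (auto simp: cis_conv_exp)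
      then show ?thesis using t by (intro insertI2 image_eqI[of _ _ "cis t"]) auto
    qed simp
  qed
  then show ?thesis by (rule finite_subset) (simp add: poly_roots_finite assms)
qed

text \<open>An isometric \<open>F\<close> satisfies \<open>F* F = 1\<close>, so its adjugate is
  \<open>d F*\<close>; the relation between \<open>f11\<close> and \<open>f22\<close> is a diagonal
  entry of this identity.\<close>

lemma isometry2_toral:
  fixes f11 f12 f21 f22 :: complex
  assumes iso: "\<And>\<alpha> \<beta>. (norm (f11 * \<alpha> + f12 * \<beta>))\<^sup>2 + (norm (f21 * \<alpha> + f22 * \<beta>))\<^sup>2 = (norm \<alpha>)\<^sup>2 + (norm \<beta>)\<^sup>2"
  defines "d \<equiv> f11 * f22 - f12 * f21"
  shows "norm d = 1" "f11 = cnj f22 * d" "norm f22 \<le> 1"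
proof -
  have sq: "of_real ((norm x)\<^sup>2) = cnj x * x" for x :: complex
    by (simp only: complex_norm_square mult.commute)
  have I: "cnj (f11 * \<alpha> + f12 * \<beta>) * (f11 * \<alpha> + f12 * \<beta>) + cnj (f21 * \<alpha> + f22 * \<beta>) * (f21 * \<alpha> + f22 * \<beta>)
      = cnj \<alpha> * \<alpha> + cnj \<beta> * \<beta>" for \<alpha> \<beta>
    unfolding sq[symmetric] of_real_add[symmetric] iso ..
  have c1: "cnj f11 * f11 + cnj f21 * f21 = 1" using I[of 1 0] by simp
  have c2: "cnj f12 * f12 + cnj f22 * f22 = 1" using I[of 0 1] by simp
  \<comment> \<open>The off-diagonal entry of \<open>F* F\<close>; its real and imaginary parts come
    from the inputs \<open>(1, 1)\<close> and \<open>(1, \<i>)\<close>.\<close>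
  define k where "k = cnj f11 * f12 + cnj f21 * f22"
  have "k + cnj k = (cnj (f11 * 1 + f12 * 1) * (f11 * 1 + f12 * 1) + cnj (f21 * 1 + f22 * 1) * (f21 * 1 + f22 * 1))
      - (cnj f11 * f11 + cnj f21 * f21) - (cnj f12 * f12 + cnj f22 * f22)"
    by (simp add: k_def algebra_simps)
  then have k1: "k + cnj k = 0" unfolding I c1 c2 by simp
  have "\<i> * (k - cnj k) = (cnj (f11 * 1 + f12 * \<i>) * (f11 * 1 + f12 * \<i>) + cnj (f21 * 1 + f22 * \<i>) * (f21 * 1 + f22 * \<i>))
      - (cnj f11 * f11 + cnj f21 * f21) - (cnj f12 * f12 + cnj f22 * f22)"
    by (simp add: k_def algebra_simps)
  then have "\<i> * (k - cnj k) = 0" unfolding I c1 c2 by simp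
  then have "k - cnj k = 0" by simp
  then have "k = 0" using k1 by (simp add: complex_eq_iff)
  moreover have "cnj f22 * f21 + cnj f12 * f11 = cnj k" by (simp add: k_def mult.commute)
  ultimately have k0: "cnj f22 * f21 = - (cnj f12 * f11)" by (simp add: eq_neg_iff_add_eq_0)
  have "cnj f22 * d = f11 * (cnj f22 * f22) - f12 * (cnj f22 * f21)"
    by (simp add: d_def algebra_simps)
  also have "\<dots> = f11 * (cnj f12 * f12 + cnj f22 * f22)" unfolding k0 by (simp add: algebra_simps)
  finally show f11: "f11 = cnj f22 * d" using c2 by simp
  have "cnj f12 * d = f22 * (cnj f12 * f11) - cnj f12 * f12 * f21"
    by (simp add: d_def algebra_simps)
  also have "cnj f12 * f11 = - (cnj f22 * f21)" using k0 by simp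
  also have "f22 * - (cnj f22 * f21) - cnj f12 * f12 * f21 = - ((cnj f12 * f12 + cnj f22 * f22) * f21)"
    by (simp add: algebra_simps)
  finally have f21: "f21 = - (cnj f12 * d)" using c2 by simp
  have r1: "(norm f11)\<^sup>2 + (norm f21)\<^sup>2 = 1" using iso[of 1 0] by simp
  have r2: "(norm f12)\<^sup>2 + (norm f22)\<^sup>2 = 1" using iso[of 0 1] by simp
  have "(norm f11)\<^sup>2 + (norm f21)\<^sup>2 = ((norm f12)\<^sup>2 + (norm f22)\<^sup>2) * (norm d)\<^sup>2"
    using arg_cong[OF f11, of norm] arg_cong[OF f21, of norm]
    by (simp add: norm_mult power_mult_distrib algebra_simps)
  then have "(norm d)\<^sup>2 = 1" unfolding r1 r2 by simp
  then show "norm d = 1" using norm_ge_zero[of d] by (auto simp: power2_eq_1_iff)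
  have "(norm f12)\<^sup>2 + (norm f22)\<^sup>2 = 1" using iso[of 0 1] by simp
  then have "(norm f22)\<^sup>2 \<le> 1" using zero_le_power2[of "norm f12"] by linarith
  then show "norm f22 \<le> 1" by (simp add: abs_square_le_1)
qed

text \<open>Off the finitely many zeros of \<open>q\<close> on the circle, \<open>x\<close> extends
  continuously, and \<open>isometry2_toral\<close> places its boundary values in the distinguished
  boundary.\<close>

lemma rational_tetra_inner_of_isometric:
  fixes f11 f12 f21 f22 q :: "complex poly"
  assumes q: "\<And>s. norm s < 1 \<Longrightarrow> poly q s \<noteq> 0"
    and contr: "\<And>s. norm s < 1 \<Longrightarrow>
      contraction2 (poly f11 s / poly q s) (poly f12 s / poly q s) (poly f21 s / poly q s) (poly f22 s / poly q s)"
    and iso: "\<And>s \<alpha> \<beta>. norm s = 1 \<Longrightarrow> poly q s \<noteq> 0 \<Longrightarrow>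
      (norm (poly f11 s / poly q s * \<alpha> + poly f12 s / poly q s * \<beta>))\<^sup>2
      + (norm (poly f21 s / poly q s * \<alpha> + poly f22 s / poly q s * \<beta>))\<^sup>2 = (norm \<alpha>)\<^sup>2 + (norm \<beta>)\<^sup>2"
  defines "x \<equiv> \<lambda>s. vector [poly f11 s / poly q s, poly f22 s / poly q s,
      poly f11 s / poly q s * (poly f22 s / poly q s) - poly f12 s / poly q s * (poly f21 s / poly q s)] :: complex ^ 3"
  shows "rational_tetra_inner x"
proof -
  have comp: "x s $ 1 = poly f11 s / poly q s" "x s $ 2 = poly f22 s / poly q s"
    "x s $ 3 = poly f11 s / poly q s * (poly f22 s / poly q s) - poly f12 s / poly q s * (poly f21 s / poly q s)" for s
    by (simp_all add: x_def)
  have hol: "(\<lambda>s. x s $ k) holomorphic_on {s. poly q s \<noteq> 0}" for k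
    using exhaust_3[of k] by (auto simp: comp intro!: holomorphic_intros)
  have "{s. poly q s \<noteq> 0} = - {s. poly q s = 0}" by auto
  moreover have q0: "q \<noteq> 0" using q[of 0] by auto
  ultimately have op: "open {s. poly q s \<noteq> 0}"
    by (metis finite_imp_closed open_Compl poly_roots_finite)
  have disc: "unit_disc \<subseteq> {s. poly q s \<noteq> 0}" using q by auto
  have "x s \<in> closed_tetrablock" if "s \<in> unit_disc" for s
    using closed_tetrablockI[OF contr comp] that by simp
  then have into_tb: "holomorphic_into_tetrablock x"
    unfolding holomorphic_into_tetrablock_def using hol disc holomorphic_on_subset by blast
  have rat: "rational_on_disc (\<lambda>s. x s $ k)" for k
  proof -
    have "\<exists>p r. \<forall>s \<in> unit_disc. poly r s \<noteq> 0 \<and> x s $ k = poly p s / poly r s"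
    proof -
      consider "k = 1" | "k = 2" | "k = 3" using exhaust_3[of k] by blast
      then show ?thesis
      proof cases
        case 1
        then show ?thesis using q by (intro exI[of _ f11] exI[of _ q]) (simp add: comp)
      next
        case 2
        then show ?thesis using q by (intro exI[of _ f22] exI[of _ q]) (simp add: comp)
      next
        case 3
        then show ?thesis using q
          by (intro exI[of _ "f11 * f22 - f12 * f21"] exI[of _ "q * q"]) (simp add: comp diff_divide_distrib)
      qed
    qed
    then show ?thesis unfolding rational_on_disc_def .
  qed
  define B where "B = {t \<in> {0..2 * pi}. poly q (cis t) = 0}"
  have "finite B" unfolding B_def by (rule finite_roots_on_circle[OF q0])
  then have "negligible B" by (rule negligible_finite)
  then have "B \<in> null_sets (lebesgue_on {0..2 * pi})"
    by (auto simp: negligible_iff_null_sets null_sets_restrict_space B_def)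
  then have "AE t in lebesgue_on {0..2 * pi}. \<exists>y \<in> distinguished_boundary.
        ((\<lambda>r. x (of_real r * cis t)) \<longlongrightarrow> y) (at_left 1)"
  proof (rule AE_I')
    show "{t \<in> space (lebesgue_on {0..2 * pi}). \<not> (\<exists>y \<in> distinguished_boundary.
        ((\<lambda>r. x (of_real r * cis t)) \<longlongrightarrow> y) (at_left 1))} \<subseteq> B"
    proof (clarify, rule ccontr)
      fix t assume t: "t \<in> space (lebesgue_on {0..2 * pi})" "t \<notin> B"
        and no: "\<not> (\<exists>y \<in> distinguished_boundary. ((\<lambda>r. x (of_real r * cis t)) \<longlongrightarrow> y) (at_left 1))"
      have qt: "poly q (cis t) \<noteq> 0" using t by (simp add: B_def)
      have "norm (cis t) = 1" by simp
      note tor = isometry2_toral[OF iso[OF this qt]]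
      have "x (cis t) \<in> distinguished_boundary"
        using tor by (intro toral_point_in_distinguished_boundary) (simp_all only: comp)
      moreover have "((\<lambda>r. x (of_real r * cis t)) \<longlongrightarrow> x (cis t)) (at_left 1)"
      proof (rule vec_tendstoI)
        fix k
        have "((\<lambda>r. of_real r * cis t) \<longlongrightarrow> of_real 1 * cis t) (at_left 1)"
          by (intro tendsto_intros)
        then have lim: "((\<lambda>r. of_real r * cis t) \<longlongrightarrow> cis t) (at_left 1)" by simp
        have "isCont (\<lambda>s. x s $ k) (cis t)"
          using holomorphic_on_imp_continuous_on[OF hol[of k]] op qt by (simp add: continuous_on_eq_continuous_at)
        then show "((\<lambda>r. x (of_real r * cis t) $ k) \<longlongrightarrow> x (cis t) $ k) (at_left 1)"
          using lim by (rule isCont_tendsto_compose)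
      qed
      ultimately show False using no by blast
    qed
  qed
  then show ?thesis
    unfolding rational_tetra_inner_def tetra_inner_def using into_tb rat by blast
qed

section \<open>Recovery of a point from three values of \<open>\<Psi>\<close>, and the
  interpolant\<close>

lemma quadratic_three_roots:
  fixes a b c :: complex and z :: "3 \<Rightarrow> complex"
  assumes z: "inj z" and r: "\<And>l. a + b * z l + c * (z l)\<^sup>2 = 0"
  shows "a = 0" "b = 0" "c = 0"
proof -
  have d: "z 1 \<noteq> z 2" "z 1 \<noteq> z 3" "z 2 \<noteq> z 3" using z by (auto dest: injD)
  have "(z l - z k) * (b + c * (z l + z k)) = (a + b * z l + c * (z l)\<^sup>2) - (a + b * z k + c * (z k)\<^sup>2)" for l k
    by (simp add: power2_eq_square algebra_simps)
  then have "(z l - z k) * (b + c * (z l + z k)) = 0" for l k unfolding r by simp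
  from this[of 1 2] this[of 1 3] have e: "b + c * (z 1 + z 2) = 0" "b + c * (z 1 + z 3) = 0" using d by auto
  have "c * (z 2 - z 3) = (b + c * (z 1 + z 2)) - (b + c * (z 1 + z 3))" by (simp add: algebra_simps)
  then have "c * (z 2 - z 3) = 0" unfolding e by simp
  then show c: "c = 0" using d by simp
  then show b: "b = 0" using e by simp
  show "a = 0" using r[of 1] b c by simp
qed

text \<open>Where \<open>x\<^sub>1 x\<^sub>2 \<noteq> x\<^sub>3\<close> is needed: only then is \<open>\<Psi>(\<cdot>, x)\<close> nonconstant, so that its values
  determine \<open>x\<close>.\<close>
lemma lft_coefficients_unique:
  fixes a b c a' b' c' :: complex and z :: "3 \<Rightarrow> complex"
  assumes z: "inj z" and ne: "a * b \<noteq> c"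
    and eq: "\<And>l. (a - c * z l) * (1 - b' * z l) = (a' - c' * z l) * (1 - b * z l)"
  shows "a' = a" "b' = b" "c' = c"
proof -
  have "(a - a') + (c' + a' * b - c - a * b') * z l + (c * b' - c' * b) * (z l)\<^sup>2 = 0" for l
    using eq[of l] by (simp add: power2_eq_square algebra_simps)
  note k = quadratic_three_roots[OF z this]
  show a: "a' = a" using k(1) by simp
  have c: "c' = c + a * b' - a * b" using k(2) unfolding a by (simp add: algebra_simps)
  have "(c - a * b) * (b' - b) = 0" using k(3) unfolding c by (simp add: algebra_simps)
  then show b: "b' = b" using ne by auto
  show "c' = c" using c b by simp
qed

text \<open>With negative terms moved across, the kernel identity equates the Gram matrices of
  \<open>u p = (1, z \<gamma>, \<lambda> m)\<close> and \<open>v p = (\<psi>, \<gamma>, m)\<close>.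
  A unitary matrix taking each \<open>u p\<close> to \<open>v p\<close> has a transfer function
  \<open>F\<close> with \<open>F(\<lambda>) (1, z \<gamma>) = (\<psi>, \<gamma>)\<close>.\<close>

lemma rational_inner_interpolant:
  fixes lam :: "'n::finite \<Rightarrow> complex" and X :: "'n \<Rightarrow> complex ^ 3" and z :: "3 \<Rightarrow> complex"
    and \<gamma> :: "'n \<times> 3 \<Rightarrow> complex" and M :: "complex ^ ('n \<times> 3) ^ ('n \<times> 3)"
  assumes z: "inj z" "\<And>l. norm (z l) < 1" and lam: "\<And>j. norm (lam j) < 1"
    and X: "\<And>j. X j \<in> closed_tetrablock" "\<And>j. X j $ 1 * X j $ 2 \<noteq> X j $ 3"
    and M: "psd M"
    and eq: "\<And>i j l k. 1 - cnj (tetra_Psi (z l) (X i)) * tetra_Psi (z k) (X j) =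
            (1 - cnj (z l) * z k) * (cnj (\<gamma> (i, l)) * \<gamma> (j, k))
            + (1 - cnj (lam i) * lam j) * M $ (i, l) $ (j, k)"
  shows "\<exists>x. rational_tetra_inner x \<and> (\<forall>j. x (lam j) = X j)"
proof -
  obtain m :: "'n \<times> 3 \<Rightarrow> complex ^ ('n \<times> 3)" where m: "\<And>p q. M $ p $ q = cip (m p) (m q)"
    using psd_Gram[OF M] by blast
  define \<psi> where "\<psi> p = (case p of (j, k) \<Rightarrow> tetra_Psi (z k) (X j))" for p
  define v :: "'n \<times> 3 \<Rightarrow> complex ^ (bool + 'n \<times> 3)" where
    "v p = (\<chi> i. case i of Inl b \<Rightarrow> if b then \<gamma> p else \<psi> p | Inr r \<Rightarrow> m p $ r)" for p
  define u where "u p = feedback_input 1 (z (snd p) * \<gamma> p) (lam (fst p)) (v p)" for p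
  have "cip (u p) (u q) = cip (v p) (v q)" for p q
  proof -
    have "cip (u p) (u q) = 1 + cnj (z (snd p) * \<gamma> p) * (z (snd q) * \<gamma> q)
        + cnj (lam (fst p)) * lam (fst q) * cip (m p) (m q)"
      by (simp add: cip_def u_def v_def feedback_input_def sum_UNIV_bool_plus sum_distrib_left mult_ac)
    moreover have "cip (v p) (v q) = cnj (\<psi> p) * \<psi> q + cnj (\<gamma> p) * \<gamma> q + cip (m p) (m q)"
      by (simp add: cip_def v_def sum_UNIV_bool_plus)
    moreover have "1 - cnj (\<psi> p) * \<psi> q = (1 - cnj (z (snd p)) * z (snd q)) * (cnj (\<gamma> p) * \<gamma> q)
        + (1 - cnj (lam (fst p)) * lam (fst q)) * cip (m p) (m q)"
      using eq[of "snd p" "fst p" "snd q" "fst q"] unfolding m by (simp add: \<psi>_def case_prod_beta)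
    ultimately show ?thesis by (simp add: algebra_simps)
  qed
  then obtain L where L: "cunitary L" "\<And>p. L *v u p = v p"
    using cunitary_of_equal_Gram[of UNIV u v] by auto
  show ?thesis
  proof (rule transfer_function_realization[OF L(1)])
    fix q P
    assume q: "\<And>s. norm s < 1 \<Longrightarrow> poly q s \<noteq> 0"
      and contr: "\<And>s. norm s \<le> 1 \<Longrightarrow> poly q s \<noteq> 0 \<Longrightarrow>
      contraction2 (poly (P False False) s / poly q s) (poly (P False True) s / poly q s)
        (poly (P True False) s / poly q s) (poly (P True True) s / poly q s)"
      and iso: "\<And>s \<alpha> \<beta>. norm s = 1 \<Longrightarrow> poly q s \<noteq> 0 \<Longrightarrow>
      (norm (poly (P False False) s / poly q s * \<alpha> + poly (P False True) s / poly q s * \<beta>))\<^sup>2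
      + (norm (poly (P True False) s / poly q s * \<alpha> + poly (P True True) s / poly q s * \<beta>))\<^sup>2
      = (norm \<alpha>)\<^sup>2 + (norm \<beta>)\<^sup>2"
      and sol: "\<And>s \<alpha> \<beta> w i. norm s < 1 \<Longrightarrow> w = L *v feedback_input \<alpha> \<beta> s w \<Longrightarrow>
      w $ Inl i = poly (P i False) s / poly q s * \<alpha> + poly (P i True) s / poly q s * \<beta>"
    define F where "F i j s = poly (P i j) s / poly q s" for i j s
    define x where "x s = (vector [F False False s, F True True s,
        F False False s * F True True s - F False True s * F True False s] :: complex ^ 3)" for s
    have "rational_tetra_inner x"
      unfolding x_def F_def by (rule rational_tetra_inner_of_isometric[OF q contr iso]) (use q in auto)
    moreover have "x (lam j) = X j" for j
    proof -
      define f where "f i k = F i k (lam j)" for i k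
      \<comment> \<open>Eliminating \<open>\<gamma>\<close> between the two rows shows that
        \<open>x (lam j)\<close> and \<open>X j\<close> have the same \<open>\<Psi>\<close> at
        \<open>z l\<close>; this is the cross-multiplied form.\<close>
      have E: "(X j $ 1 - X j $ 3 * z l) * (1 - f True True * z l)
          = (f False False - (f False False * f True True - f False True * f True False) * z l) * (1 - X j $ 2 * z l)" for l
      proof -
        have "v (j, l) = L *v feedback_input 1 (z l * \<gamma> (j, l)) (lam j) (v (j, l))"
          using L(2)[of "(j, l)"] by (simp add: u_def)
        note s = sol[OF lam this]
        have s1: "\<psi> (j, l) = f False False + f False True * (z l * \<gamma> (j, l))"
          using s[of False] by (simp add: v_def f_def F_def)
        have s2: "\<gamma> (j, l) = f True False + f True True * (z l * \<gamma> (j, l))"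
          using s[of True] by (simp add: v_def f_def F_def)
        have g: "\<gamma> (j, l) * (1 - f True True * z l) = f True False"
          using s2 by (simp add: algebra_simps)
        have "\<psi> (j, l) * (1 - f True True * z l)
            = f False False * (1 - f True True * z l) + f False True * z l * (\<gamma> (j, l) * (1 - f True True * z l))"
          unfolding s1 by (simp add: algebra_simps)
        also have "\<dots> = f False False - (f False False * f True True - f False True * f True False) * z l"
          unfolding g by (simp add: algebra_simps)
        finally have A: "\<psi> (j, l) * (1 - f True True * z l)
            = f False False - (f False False * f True True - f False True * f True False) * z l" .
        have "X j $ 2 * z l - 1 \<noteq> 0" using closed_tetrablock_denom_ne[OF X(1) z(2)] by simp
        then have "\<psi> (j, l) * (X j $ 2 * z l - 1) = z l * X j $ 3 - X j $ 1"
          by (simp add: \<psi>_def tetra_Psi_def)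
        then have B: "X j $ 1 - X j $ 3 * z l = \<psi> (j, l) * (1 - X j $ 2 * z l)"
          by (simp add: algebra_simps)
        show ?thesis unfolding B A[symmetric] by simp
      qed
      show ?thesis
        using lft_coefficients_unique[OF z(1) X(2) E] by (simp add: vec_eq_iff forall_3 x_def f_def)
    qed
    ultimately show ?thesis by blast
  qed
qed

section \<open>The implications (ii) to (i), (i) to (iii), (iii) to (iv) and (iv) to (ii)\<close>

theorem theorem8p1:
  fixes lam :: "'n::finite \<Rightarrow> complex" and X :: "'n \<Rightarrow> complex ^ 3"
  assumes "inj lam"
    and "\<And>j. lam j \<in> unit_disc"
    and "\<And>j. X j \<in> closed_tetrablock"
    and "\<And>j. X j $ 1 * X j $ 2 \<noteq> X j $ 3"
  defines "cond_i \<equiv> \<exists>x. holomorphic_into_tetrablock x \<and> (\<forall>j. x (lam j) = X j)"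
    and "cond_ii \<equiv> \<exists>x. rational_tetra_inner x \<and> (\<forall>j. x (lam j) = X j)"
    and "cond_iii \<equiv> \<forall>z :: 3 \<Rightarrow> complex. inj z \<and> range z \<subseteq> unit_disc \<longrightarrow>
       (\<exists>N M :: complex ^ ('n \<times> 3) ^ ('n \<times> 3). psd N \<and> rank N \<le> 1 \<and> psd M \<and>
         (\<forall>i j l k. 1 - cnj (tetra_Psi (z l) (X i)) * tetra_Psi (z k) (X j) =
            (1 - cnj (z l) * z k) * N $ (i, l) $ (j, k)
            + (1 - cnj (lam i) * lam j) * M $ (i, l) $ (j, k)))"
    and "cond_iv \<equiv> \<exists>z :: 3 \<Rightarrow> complex. inj z \<and> range z \<subseteq> unit_disc \<and>
       (\<exists>N M :: complex ^ ('n \<times> 3) ^ ('n \<times> 3). psd N \<and> rank N \<le> 1 \<and> psd M \<and>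
         loewner_ge
           (\<chi> p q. case (p, q) of ((i, l), (j, k)) \<Rightarrow>
              1 - cnj (tetra_Psi (z l) (X i)) * tetra_Psi (z k) (X j))
           ((\<chi> p q. case (p, q) of ((i, l), (j, k)) \<Rightarrow>
              (1 - cnj (z l) * z k) * N $ (i, l) $ (j, k))
            + (\<chi> p q. case (p, q) of ((i, l), (j, k)) \<Rightarrow>
              (1 - cnj (lam i) * lam j) * M $ (i, l) $ (j, k))))"
  shows "(cond_i \<longleftrightarrow> cond_ii) \<and> (cond_ii \<longleftrightarrow> cond_iii) \<and> (cond_iii \<longleftrightarrow> cond_iv)"
proof -
  have lam: "norm (lam j) < 1" for j using assms(2)[of j] by simp
  have ne: "1 - cnj (lam i) * lam j \<noteq> 0" for i j by (rule one_minus_cnj_mult_ne_0[OF lam lam])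
  have "cond_i" if cond_ii
    using that unfolding cond_i_def cond_ii_def rational_tetra_inner_def tetra_inner_def by blast
  moreover have "cond_iii" if c: cond_i
    unfolding cond_iii_def
  proof (intro allI impI)
    fix z :: "3 \<Rightarrow> complex" assume "inj z \<and> range z \<subseteq> unit_disc"
    then have "z l \<in> unit_disc" for l by blast
    then have z: "norm (z l) < 1" for l by simp
    obtain x where x: "holomorphic_into_tetrablock x" "\<And>j. x (lam j) = X j"
      using c unfolding cond_i_def by blast
    define \<psi> where "\<psi> p = tetra_Psi (z (snd p)) (X (fst p))" for p
    \<comment> \<open>Any node can serve as the point where
      \<open>x\<^sub>1 x\<^sub>2 \<noteq> x\<^sub>3\<close>; \<open>undefined\<close> names
      one.\<close>
    obtain \<gamma> where \<gamma>: "defect_nonneg (\<lambda>p. lam (fst p)) (\<lambda>p. z (snd p)) \<psi> \<gamma>"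
      using defect_nonneg_exists[OF x(1), of "lam undefined" "\<lambda>p. lam (fst p)" "\<lambda>p. z (snd p)"]
        assms(2,4) lam z unfolding \<psi>_def x(2) by blast
    define N :: "complex ^ ('n \<times> 3) ^ ('n \<times> 3)" where "N = (\<chi> p q. cnj (\<gamma> p) * \<gamma> q)"
    define M :: "complex ^ ('n \<times> 3) ^ ('n \<times> 3)" where
      "M = (\<chi> p q. defect_entry (\<lambda>p. lam (fst p)) (\<lambda>p. z (snd p)) \<psi> \<gamma> p q)"
    have "hermitian M" unfolding hermitian_def M_def defect_entry_def by (simp add: mult_ac)
    moreover have "0 \<le> Re (\<Sum>p\<in>UNIV. \<Sum>q\<in>UNIV. cnj (v $ p) * M $ p $ q * v $ q)" for v
      unfolding M_def vec_lambda_beta by (rule \<gamma>[unfolded defect_nonneg_def, rule_format])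
    ultimately have "psd M" unfolding psd_def by (intro conjI allI)
    moreover have "psd N" "rank N \<le> 1" unfolding N_def by (rule psd_outer_product, rule rank_outer_product)
    moreover have "1 - cnj (tetra_Psi (z l) (X i)) * tetra_Psi (z k) (X j) =
            (1 - cnj (z l) * z k) * N $ (i, l) $ (j, k)
            + (1 - cnj (lam i) * lam j) * M $ (i, l) $ (j, k)" for i j l k
      using ne[of i j] by (simp add: N_def M_def defect_entry_def \<psi>_def)
    ultimately show "\<exists>N M :: complex ^ ('n \<times> 3) ^ ('n \<times> 3). psd N \<and> rank N \<le> 1 \<and> psd M \<and>
         (\<forall>i j l k. 1 - cnj (tetra_Psi (z l) (X i)) * tetra_Psi (z k) (X j) =
            (1 - cnj (z l) * z k) * N $ (i, l) $ (j, k)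
            + (1 - cnj (lam i) * lam j) * M $ (i, l) $ (j, k))" by (intro exI[of _ N] exI[of _ M] conjI allI)
  qed
  moreover have "cond_iv" if c: cond_iii
  proof -
    \<comment> \<open>An arbitrary choice of three distinct points of the disc.\<close>
    define z :: "3 \<Rightarrow> complex" where "z l = (if l = 1 then 0 else if l = 2 then 1 / 2 else 1 / 3)" for l
    have z: "inj z \<and> range z \<subseteq> unit_disc"
      by (auto simp: z_def inj_def forall_3 norm_divide)
    from c[unfolded cond_iii_def, THEN spec, THEN mp, OF z]
    obtain N M :: "complex ^ ('n \<times> 3) ^ ('n \<times> 3)" where NM: "psd N" "rank N \<le> 1" "psd M"
      and eq: "\<forall>i j l k. 1 - cnj (tetra_Psi (z l) (X i)) * tetra_Psi (z k) (X j) =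
            (1 - cnj (z l) * z k) * N $ (i, l) $ (j, k) + (1 - cnj (lam i) * lam j) * M $ (i, l) $ (j, k)"
      by (elim exE conjE)
    have psd_0: "psd (0 :: complex ^ ('n \<times> 3) ^ ('n \<times> 3))" by (simp add: psd_def hermitian_def)
    have slack: "(\<chi> p q. case (p, q) of ((i, l), (j, k)) \<Rightarrow>
              1 - cnj (tetra_Psi (z l) (X i)) * tetra_Psi (z k) (X j))
       - ((\<chi> p q. case (p, q) of ((i, l), (j, k)) \<Rightarrow> (1 - cnj (z l) * z k) * N $ (i, l) $ (j, k))
            + (\<chi> p q. case (p, q) of ((i, l), (j, k)) \<Rightarrow> (1 - cnj (lam i) * lam j) * M $ (i, l) $ (j, k))) = 0"
      using eq by (simp add: vec_eq_iff)
    show ?thesis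
      unfolding cond_iv_def loewner_ge_def
      by (intro exI[of _ z] conjI exI[of _ N] exI[of _ M] NM z[THEN conjunct1] z[THEN conjunct2], subst slack, rule psd_0)
  qed
  moreover have "cond_ii" if c: cond_iv
  proof -
    obtain z :: "3 \<Rightarrow> complex" and N M :: "complex ^ ('n \<times> 3) ^ ('n \<times> 3)"
      where z: "inj z" "range z \<subseteq> unit_disc" and NM: "psd N" "rank N \<le> 1" "psd M"
      and ge: "loewner_ge
           (\<chi> p q. case (p, q) of ((i, l), (j, k)) \<Rightarrow>
              1 - cnj (tetra_Psi (z l) (X i)) * tetra_Psi (z k) (X j))
           ((\<chi> p q. case (p, q) of ((i, l), (j, k)) \<Rightarrow> (1 - cnj (z l) * z k) * N $ (i, l) $ (j, k))
            + (\<chi> p q. case (p, q) of ((i, l), (j, k)) \<Rightarrow> (1 - cnj (lam i) * lam j) * M $ (i, l) $ (j, k)))"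
      using c unfolding cond_iv_def by blast
    obtain \<gamma> where \<gamma>: "\<And>p q. N $ p $ q = cnj (\<gamma> p) * \<gamma> q" using psd_rank_le_1[OF NM(1,2)] by blast
    define R :: "complex ^ ('n \<times> 3) ^ ('n \<times> 3)" where
      "R = (\<chi> p q. case (p, q) of ((i, l), (j, k)) \<Rightarrow>
              1 - cnj (tetra_Psi (z l) (X i)) * tetra_Psi (z k) (X j))
       - ((\<chi> p q. case (p, q) of ((i, l), (j, k)) \<Rightarrow> (1 - cnj (z l) * z k) * N $ (i, l) $ (j, k))
            + (\<chi> p q. case (p, q) of ((i, l), (j, k)) \<Rightarrow> (1 - cnj (lam i) * lam j) * M $ (i, l) $ (j, k)))"
    have "psd R" using ge unfolding loewner_ge_def R_def .
    \<comment> \<open>Multiplied by \<open>1 - cnj (lam i) * lam j\<close>, this summand of the new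
      \<open>M\<close> gives back the slack \<open>R\<close>, which turns the inequality into an
      equality.\<close>
    then have "psd (\<chi> p q. R $ p $ q / (1 - cnj (lam (fst p)) * lam (fst q)))"
      by (rule psd_Szego_quotient) (rule lam)
    then have M': "psd (M + (\<chi> p q. R $ p $ q / (1 - cnj (lam (fst p)) * lam (fst q))))"
      by (rule psd_add[OF NM(3)])
    have "z l \<in> unit_disc" for l using z(2) by blast
    then have zn: "norm (z l) < 1" for l by simp
    have "1 - cnj (tetra_Psi (z l) (X i)) * tetra_Psi (z k) (X j) =
            (1 - cnj (z l) * z k) * (cnj (\<gamma> (i, l)) * \<gamma> (j, k)) + (1 - cnj (lam i) * lam j) *
              (M + (\<chi> p q. R $ p $ q / (1 - cnj (lam (fst p)) * lam (fst q)))) $ (i, l) $ (j, k)" for i j l k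
    proof -
      have "(1 - cnj (lam i) * lam j) *
              (M + (\<chi> p q. R $ p $ q / (1 - cnj (lam (fst p)) * lam (fst q)))) $ (i, l) $ (j, k)
          = (1 - cnj (lam i) * lam j) * M $ (i, l) $ (j, k) + R $ (i, l) $ (j, k)"
        using ne[of i j] by (simp add: distrib_left)
      then show ?thesis by (simp add: R_def \<gamma>)
    qed
    from rational_inner_interpolant[OF z(1) zn lam assms(3) assms(4) M' this]
    show ?thesis unfolding cond_ii_def .
  qed
  ultimately show ?thesis by argo
qed

end
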